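(* Let $\beta\in(1,2]$, $b>0$, $\psi(r)=e^{br^\beta}$ for $r\ge b^{-1/\beta}$, and let $f:\mathbb{R}^d\to\mathbb{R}$ be an isotropic potential with twice continuously differentiable profile, with associated probability density $\pi=Z^{-1}e^{-f}$. Suppose that $f$ satisfies the dissipativity assumption with parameters $\alpha,A,B$: there are $A,B,N_1>0$ and $\alpha\in[1,2]$ such that for all $|x|>N_1$, $$f'(\psi(|x|))\psi'(|x|)|x|-b\beta d|x|^\beta+(d-\beta)>A|x|^\alpha-B.$$ Let $\vartheta$ be the parameter of the non-local Dirichlet form $\mathcal E$ given in the context. Then: (1) If $\alpha>\beta$, or $\alpha=\beta$ and $\vartheta<A\beta^{-1}b^{-1}$, then $\pi$ satisfies the super Poincaré inequality (with rate function $S(r)$ as in the context) with $$\omega(x)=\frac{C}{2^{d+\vartheta}}|x|^{A\alpha^{-1}b^{-\frac{\alpha}{\beta}}\log^{\frac{\alpha}{\beta}-1}(|x|)-\vartheta}\log^{-\frac{B}{\beta}}(|x|),$$ for some positive constant $C$. (2) If $\alpha=\beta$ and $\vartheta\ge A\beta^{-1}b^{-1}$, then $\pi$ satisfies the weak Poincaré inequality (with rate function $W(r)$ as in the context).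
   Context: Isotropic: $f(x)=f(|x|)$, the same letter denoting a twice continuously differentiable profile $f:\mathbb{R}\to\mathbb{R}$; $f'$ is the derivative of the profile. $Z=\int e^{-f}$ is the (unknown) normalization constant. Dirichlet form: for the probability measure $\mu$ with density $\pi$, $\mathcal E(\phi)=\iint_{\{x\ne y\}}\frac{(\phi(x)-\phi(y))^2}{|x-y|^{d+\vartheta}}\,dx\,\mu(dy)$, the form associated with $\vartheta$-stable driven diffusions, with domain $\mathcal D(\mathcal E)=\{\phi\in L^2(\mu):\mathcal E(\phi)<\infty\}$. Write $\mu(\varphi)=\int\varphi\,d\mu$. Weak Poincaré inequality: $\mathrm{Var}_\mu(\phi)\le W(r)\mathcal E(\phi)+r\|\phi\|_\infty^2$ for all $\phi\in\mathcal D(\mathcal E)$ and $r>0$, where $$W(r)=\inf_{s>0}\Big\{\frac{1}{\inf_{0<|x-y|\le s}[(e^{f(x)}+e^{f(y)})|x-y|^{-(d+\vartheta)}]}:\iint_{|x-y|>s}e^{-f(x)}e^{-f(y)}dxdy\le r/2\Big\}.$$ Super Poincaré inequality: $\mu(\phi^2)\le r\,\mathcal E(\phi)+S(r)\mu(|\phi|)^2$ for all $\phi\in\mathcal D(\mathcal E)$ and $r>0$, where, for a function $\omega$ depending on $f$, $$S(r)=\inf_{t,s>0}\Big\{\frac{2\mu(\omega)}{\inf_{|x|\ge t}\omega(x)}+S_t(t\wedge s):\frac{2}{\inf_{|x|\ge t}\omega(x)}+s\le r\Big\},$$ and for any $t>0$ $$S_t(s)=\inf_{u>0}\Big\{\frac{(\sup_{|z|\le2t}e^{f(z)})^2}{u^d\inf_{|z|\le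 t}e^{f(z)}}:\frac{u^\vartheta\sup_{|z|\le2t}e^{f(z)}}{\inf_{|z|\le t}e^{f(z)}}\le s\Big\}.$$
   Formalization: In W and S the potential f is replaced by f + log Z, so that e^{-f} is the probability density π; the formula for ω is used only for |x| ≥ R, for some R > 1 that exists along with C, and ω is constant for |x| < R, since the literal formula is undefined for |x| < 1 and the claim can fail. *)

theory Defs
  imports "HOL-Probability.Essential_Supremum"
begin

definition twice_cont_diff :: "(real \<Rightarrow> real) \<Rightarrow> bool" where
  "twice_cont_diff f \<longleftrightarrow> f C1_differentiable_on UNIV \<and> deriv f C1_differentiable_on UNIV"

definition norm_const :: "('a::euclidean_space \<Rightarrow> real) \<Rightarrow> real" where
  "norm_const V = (LINT x|lborel. exp (- V x))"

definition gibbs :: "('a::euclidean_space \<Rightarrow> real) \<Rightarrow> 'a measure" where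
  "gibbs V = density lborel (\<lambda>x. ennreal (exp (- V x) / norm_const V))"

text \<open>The representative \<open>V + ln Z\<close> of the potential, for which \<open>exp (- V)\<close> is itself the probability
  density. The two rate functions below are not invariant under adding a constant to \<open>V\<close>
  (the measure and the Dirichlet form are), and they are the correct ones for this representative.\<close>

definition normalized_potential :: "('a::euclidean_space \<Rightarrow> real) \<Rightarrow> 'a \<Rightarrow> real" where
  "normalized_potential V x = V x + ln (norm_const V)"

text \<open>\<open>\<psi>\<close> is the radial transformation and \<open>f\<close> the profile; \<open>d\<close> is the dimension of \<open>'a\<close>.\<close>

definition dissipative ::
  "'a::euclidean_space itself \<Rightarrow> real \<Rightarrow> real \<Rightarrow> (real \<Rightarrow> real) \<Rightarrow> (real \<Rightarrow> real)
    \<Rightarrow> real \<Rightarrow> real \<Rightarrow> real \<Rightarrow> bool" where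
  "dissipative TYPE('a) b \<beta> \<psi> f \<alpha> A B \<longleftrightarrow>
     A > 0 \<and> B > 0 \<and> 1 \<le> \<alpha> \<and> \<alpha> \<le> 2 \<and>
     (\<exists>N\<^sub>1>0. \<forall>x::'a. norm x > N\<^sub>1 \<longrightarrow>
        deriv f (\<psi> (norm x)) * deriv \<psi> (norm x) * norm x
          - b * \<beta> * real DIM('a) * norm x powr \<beta> + (real DIM('a) - \<beta>)
        > A * norm x powr \<alpha> - B)"

definition dirichlet_form :: "real \<Rightarrow> 'a::euclidean_space measure \<Rightarrow> ('a \<Rightarrow> real) \<Rightarrow> ennreal" where
  "dirichlet_form \<theta> M \<phi> =
     (\<integral>\<^sup>+y. (\<integral>\<^sup>+x\<in>{x. x \<noteq> y}.
        ennreal ((\<phi> x - \<phi> y)\<^sup>2 / norm (x - y) powr (real DIM('a) + \<theta>)) \<partial>lborel) \<partial>M)"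

definition dirichlet_domain :: "real \<Rightarrow> 'a::euclidean_space measure \<Rightarrow> ('a \<Rightarrow> real) set" where
  "dirichlet_domain \<theta> M =
     {\<phi>. \<phi> \<in> borel_measurable M \<and> integrable M (\<lambda>x. (\<phi> x)\<^sup>2) \<and> dirichlet_form \<theta> M \<phi> < \<infinity>}"

text \<open>Rate functions are \<open>ennreal\<close>-valued so that infima over empty sets are \<open>\<infinity>\<close> and not junk;
  both inequalities include that the rate function is finite.\<close>

definition weak_poincare ::
  "real \<Rightarrow> 'a::euclidean_space measure \<Rightarrow> (real \<Rightarrow> ennreal) \<Rightarrow> bool" where
  "weak_poincare \<theta> M W \<longleftrightarrow>
     (\<forall>r>0. W r < \<infinity> \<and>
       (\<forall>\<phi>\<in>dirichlet_domain \<theta> M.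
          ennreal (LINT x|M. (\<phi> x - (LINT y|M. \<phi> y))\<^sup>2)
          \<le> W r * dirichlet_form \<theta> M \<phi> + ennreal r * (esssup M (\<lambda>x. ennreal \<bar>\<phi> x\<bar>))\<^sup>2))"

definition super_poincare ::
  "real \<Rightarrow> 'a::euclidean_space measure \<Rightarrow> (real \<Rightarrow> ennreal) \<Rightarrow> bool" where
  "super_poincare \<theta> M S \<longleftrightarrow>
     (\<forall>r>0. S r < \<infinity> \<and>
       (\<forall>\<phi>\<in>dirichlet_domain \<theta> M.
          ennreal (LINT x|M. (\<phi> x)\<^sup>2)
          \<le> ennreal r * dirichlet_form \<theta> M \<phi> + S r * ennreal ((LINT x|M. \<bar>\<phi> x\<bar>)\<^sup>2)))"

definition weak_rate :: "real \<Rightarrow> ('a::euclidean_space \<Rightarrow> real) \<Rightarrow> real \<Rightarrow> ennreal" where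
  "weak_rate \<theta> V r =
     (INF s\<in>{s. s > 0 \<and>
         (\<integral>\<^sup>+x. (\<integral>\<^sup>+y\<in>{y. norm (x - y) > s}.
            ennreal (exp (- V x) * exp (- V y)) \<partial>lborel) \<partial>lborel) \<le> ennreal (r / 2)}.
       1 / (INF (x, y)\<in>{(x, y). 0 < norm (x - y) \<and> norm (x - y) \<le> s}.
              ennreal ((exp (V x) + exp (V y)) * norm (x - y) powr - (real DIM('a) + \<theta>))))"

definition local_rate :: "real \<Rightarrow> ('a::euclidean_space \<Rightarrow> real) \<Rightarrow> real \<Rightarrow> real \<Rightarrow> ennreal" where
  "local_rate \<theta> V t s =
     (let sup2t = (SUP z\<in>{z. norm z \<le> 2 * t}. ennreal (exp (V z)));
          inft = (INF z\<in>{z. norm z \<le> t}. ennreal (exp (V z)))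
      in INF u\<in>{u. u > 0 \<and> ennreal (u powr \<theta>) * sup2t / inft \<le> ennreal s}.
           sup2t\<^sup>2 / (ennreal (u ^ DIM('a)) * inft))"

definition super_rate ::
  "real \<Rightarrow> ('a::euclidean_space \<Rightarrow> real) \<Rightarrow> ('a \<Rightarrow> real) \<Rightarrow> real \<Rightarrow> ennreal" where
  "super_rate \<theta> V \<omega> r =
     (INF (t, s)\<in>{(t, s). t > 0 \<and> s > 0 \<and>
         2 / (INF x\<in>{x. norm x \<ge> t}. ennreal (\<omega> x)) + ennreal s \<le> ennreal r}.
       2 * (\<integral>\<^sup>+x. ennreal (\<omega> x) \<partial>gibbs V) / (INF x\<in>{x. norm x \<ge> t}. ennreal (\<omega> x))
         + local_rate \<theta> V t (min t s))"

text \<open>The formula for \<open>\<omega>\<close> is a large-\<open>\<bar>x\<bar>\<close> expression: \<open>ln \<bar>x\<bar>\<close> is negative for \<open>\<bar>x\<bar> < 1\<close>, and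
  \<open>(ln \<bar>x\<bar>) powr (- B / \<beta>)\<close> blows up at \<open>\<bar>x\<bar> = 1\<close>, non-integrably if \<open>B \<ge> \<beta>\<close>. It is therefore used
  for \<open>\<bar>x\<bar> \<ge> R\<close>, where \<open>R > 1\<close>, and continued by its value at \<open>\<bar>x\<bar> = R\<close> inside the ball.\<close>

definition omega ::
  "real \<Rightarrow> real \<Rightarrow> real \<Rightarrow> real \<Rightarrow> real \<Rightarrow> real \<Rightarrow> real \<Rightarrow> real \<Rightarrow> 'a::euclidean_space \<Rightarrow> real" where
  "omega \<theta> b \<beta> \<alpha> A B C R x =
     (let \<rho> = max R (norm x)
      in C / 2 powr (real DIM('a) + \<theta>)
         * \<rho> powr (A / \<alpha> * b powr - (\<alpha> / \<beta>) * ln \<rho> powr (\<alpha> / \<beta> - 1) - \<theta>)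
         * ln \<rho> powr - (B / \<beta>))"

end

theory Submission
  imports Defs "HOL-Probability.Probability_Measure" "HOL-Real_Asymp.Real_Asymp"
begin

text \<open>
  Write \<open>V\<close> for the normalized potential, \<open>g\<close> for its profile and \<open>p = d + \<theta>\<close>. If
  \<open>\<bar>x - y\<bar>\<^sup>p \<le> r (e\<^bsup>V x\<^esup> + e\<^bsup>V y\<^esup>)\<close> on a set of pairs, then the integral of \<open>(\<phi> x - \<phi> y)\<^sup>2\<close> against
  \<open>\<mu> \<otimes> \<mu>\<close> over this set is at most \<open>2 r\<close> times the Dirichlet form. Splitting pairs by their distance
  gives the weak Poincare inequality.

  Integrating the dissipativity condition after the substitution \<open>\<rho> = \<psi> r\<close> gives
  \<open>g \<rho> \<ge> c + \<kappa> (ln \<rho>)\<^sup>q + d ln \<rho> - k ln (ln \<rho>)\<close> with \<open>\<kappa> = A / \<alpha> b powr (- \<alpha> / \<beta>)\<close>, \<open>q = \<alpha> / \<beta>\<close>. The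
  power of the logarithm lost here is larger than the power \<open>B / \<beta>\<close> that the weight \<open>\<omega>\<close> allows,
  so \<open>\<omega>\<close> is not pointwise dominated by \<open>inf\<^sub>y (e\<^bsup>V x\<^esup> + e\<^bsup>V y\<^esup>) / \<bar>x - y\<bar>\<^sup>p\<close>, and the standard criterion does not
  apply directly. The loss is recovered from the local rate, which exceeds by a power of \<open>t\<close> what
  is needed: outside a ball of radius about \<open>t powr (5/4)\<close> the kernel comparison holds with constant \<open>r / 8\<close>, and
  inside this ball \<open>\<phi>\<close> is compared with its averages over balls of radius of order \<open>r powr (1 / \<theta>)\<close>, at a
  cost still dominated by the local rate at \<open>t\<close>.
\<close>

text \<open>Only a lower bound on \<open>g\<close> is at hand, so \<open>exp V\<close> may be far
  too large on the ball of radius \<open>T = t powr (5/4)\<close>. That ball is shrunk, if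
  necessary, to the radius where \<open>exp (g \<rho>)\<close> reaches
  \<open>K * T powr (d + \<theta>)\<close> with \<open>K = 2 powr (d + \<theta> + 3) / r\<close>.
  This one number bounds \<open>exp V\<close> from above inside, and by monotonicity of
  \<open>g\<close> it yields the kernel comparison between the new radius and \<open>T\<close>.

  The exponent 5/4 results from counting powers. With \<open>T = t powr \<gamma>\<close>, averaging
  costs a constant of order \<open>T powr (2 * (d + \<theta>)) * r powr (- 2 - 2 * d /
  \<theta>)\<close>, and the constraint in the rate forces \<open>1 / r \<le> w t\<close>, where
  \<open>w\<close> is the weight up to constants. The local rate offers
  \<open>exp (g t) powr P * r powr (- d / \<theta>)\<close> with
  \<open>P = 2 + d / \<theta>\<close>. After cancelling \<open>r powr (- d / \<theta>)\<close> and
  the leading exponentials there remains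
  \<open>2 * \<gamma> * (d + \<theta>) < P * (d + \<theta>)\<close>, that is
  \<open>\<gamma> < 1 + d / (2 * \<theta>)\<close>. The comparison outside needs
  \<open>\<gamma> > 1\<close>. Since \<open>d \<ge> 1\<close> and \<open>\<theta> < 2\<close>, the
  value 5/4 is always admissible.\<close>

text \<open>Both rates are infima over parameters, so bounds for single parameters must pass to the
  infimum. Finiteness of \<open>c\<close> allows subtracting it, and a finite nonzero
  \<open>e\<close> can be divided out. For \<open>e = 0\<close> the right side is just
  \<open>c\<close>, and some member of \<open>S\<close> must exist to give
  \<open>a \<le> c\<close>.\<close>

lemma le_INF_mult_add:
  fixes w :: "'i \<Rightarrow> ennreal" and a c e :: ennreal
  assumes "S \<noteq> {}" and "e < \<infinity>" and "c < \<infinity>" and le: "\<And>s. s \<in> S \<Longrightarrow> a \<le> w s * e + c"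
  shows "a \<le> (INF s\<in>S. w s) * e + c"
proof (cases "e = 0")
  case True
  with assms show ?thesis by auto
next
  case False
  have "(a - c) / e \<le> w s" if "s \<in> S" for s
  proof -
    have "a - c \<le> w s * e"
      using le[OF that] \<open>c < \<infinity>\<close> by (auto simp: ennreal_minus_le_iff add.commute)
    then show ?thesis
      using False \<open>e < \<infinity>\<close>
      by (intro divide_le_posI_ennreal) (auto simp: mult.commute zero_less_iff_neq_zero)
  qed
  then have "(a - c) / e \<le> (INF s\<in>S. w s)"
    by (intro INF_greatest)
  then have "(a - c) / e * e \<le> (INF s\<in>S. w s) * e"
    by (intro mult_right_mono) auto
  moreover have "(a - c) / e * e = a - c"
    using False \<open>e < \<infinity>\<close> by (simp add: ennreal_divide_times)
  ultimately show ?thesis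
    using \<open>c < \<infinity>\<close> by (simp add: ennreal_minus_le_iff add.commute)
qed

lemma square_add_le: "(a + b)\<^sup>2 \<le> 2 * a\<^sup>2 + 2 * (b::real)\<^sup>2"
  using sum_squares_bound[of a b] by (simp add: power2_sum)

section \<open>Gibbs measure, Dirichlet form and variance\<close>

locale gibbs_potential =
  fixes V :: "'a::euclidean_space \<Rightarrow> real" and \<theta> :: real
  assumes V_measurable [measurable]: "V \<in> borel_measurable borel"
    and mass: "(\<integral>\<^sup>+x. ennreal (exp (- V x)) \<partial>lborel) = 1"
    and \<theta>_pos: "0 < \<theta>"
begin

abbreviation \<mu> :: "'a measure" where
  "\<mu> \<equiv> density lborel (\<lambda>x. ennreal (exp (- V x)))"

abbreviation D :: "('a \<Rightarrow> real) \<Rightarrow> 'a \<Rightarrow> 'a \<Rightarrow> real" where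
  "D \<phi> x y \<equiv> (\<phi> x - \<phi> y)\<^sup>2 / norm (x - y) powr (real DIM('a) + \<theta>)"

sublocale prob_space \<mu>
  by (rule prob_spaceI) (simp add: emeasure_density mass)

lemma dirichlet_form_eq:
  fixes \<phi> :: "'a \<Rightarrow> real"
  assumes [measurable]: "\<phi> \<in> borel_measurable borel"
  shows "dirichlet_form \<theta> \<mu> \<phi> =
    (\<integral>\<^sup>+y. \<integral>\<^sup>+x. ennreal (exp (- V y) * D \<phi> x y) \<partial>lborel \<partial>lborel)"
proof -
  \<comment> \<open>The diagonal may be added back: the numerator of \<open>D \<phi> x x\<close>
    vanishes.\<close>
  have "dirichlet_form \<theta> \<mu> \<phi> = (\<integral>\<^sup>+y. \<integral>\<^sup>+x. ennreal (D \<phi> x y) \<partial>lborel \<partial>\<mu>)"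
    unfolding dirichlet_form_def by (intro nn_integral_cong) (auto simp: indicator_def)
  also have "\<dots> = (\<integral>\<^sup>+y. ennreal (exp (- V y)) * (\<integral>\<^sup>+x. ennreal (D \<phi> x y) \<partial>lborel) \<partial>lborel)"
    by (intro nn_integral_density) measurable
  also have "\<dots> = (\<integral>\<^sup>+y. \<integral>\<^sup>+x. ennreal (exp (- V y)) * ennreal (D \<phi> x y) \<partial>lborel \<partial>lborel)"
    by (intro nn_integral_cong nn_integral_cmult[symmetric]) measurable
  finally show ?thesis
    by (simp add: ennreal_mult'[symmetric])
qed

lemma dirichlet_form_eq':
  fixes \<phi> :: "'a \<Rightarrow> real"
  assumes [measurable]: "\<phi> \<in> borel_measurable borel"
  shows "dirichlet_form \<theta> \<mu> \<phi> =
    (\<integral>\<^sup>+x. \<integral>\<^sup>+y. ennreal (exp (- V x) * D \<phi> x y) \<partial>lborel \<partial>lborel)"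
  by (simp add: dirichlet_form_eq norm_minus_commute power2_commute)

text \<open>Multiplying the hypothesis by \<open>exp (- V x) * exp (- V y)\<close> turns its right
  side into \<open>r * (exp (- V x) + exp (- V y))\<close>, so the product density gives way to two
  one-sided weights. Each of them integrates to the Dirichlet form by symmetry of the kernel, whence
  the factor 2.\<close>

lemma kernel_comparison:
  fixes \<phi> :: "'a \<Rightarrow> real"
  assumes [measurable]: "\<phi> \<in> borel_measurable borel" "Q \<in> sets (borel \<Otimes>\<^sub>M borel)"
    and "r \<ge> 0"
    and Q: "\<And>x y. (x, y) \<in> Q \<Longrightarrow> norm (x - y) powr (real DIM('a) + \<theta>) \<le> r * (exp (V x) + exp (V y))"
  shows "(\<integral>\<^sup>+x. \<integral>\<^sup>+y. ennreal ((\<phi> x - \<phi> y)\<^sup>2) * indicator Q (x, y) \<partial>\<mu> \<partial>\<mu>)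
    \<le> ennreal (2 * r) * dirichlet_form \<theta> \<mu> \<phi>"
proof -
  have point: "exp (- V x) * (exp (- V y) * ((\<phi> x - \<phi> y)\<^sup>2 * indicator Q (x, y)))
      \<le> r * (exp (- V x) * D \<phi> x y) + r * (exp (- V y) * D \<phi> x y)" for x y
  proof (cases "x \<noteq> y \<and> (x, y) \<in> Q")
    case True
    then have n: "norm (x - y) powr (real DIM('a) + \<theta>) > 0" by simp
    have "norm (x - y) powr (real DIM('a) + \<theta>) * (exp (- V x) * exp (- V y)) \<le>
        r * (exp (V x) + exp (V y)) * (exp (- V x) * exp (- V y))"
      using Q True by (intro mult_right_mono) auto
    also have "\<dots> = r * (exp (- V x) + exp (- V y))"
      by (simp add: exp_minus field_simps)
    finally have *: "norm (x - y) powr (real DIM('a) + \<theta>) * (exp (- V x) * exp (- V y)) \<le> r * (exp (- V x) + exp (- V y))" .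
    have "exp (- V x) * (exp (- V y) * (\<phi> x - \<phi> y)\<^sup>2)
        = norm (x - y) powr (real DIM('a) + \<theta>) * (exp (- V x) * exp (- V y)) * D \<phi> x y"
      using n by simp
    also have "\<dots> \<le> r * (exp (- V x) + exp (- V y)) * D \<phi> x y"
      using * by (intro mult_right_mono) auto
    finally show ?thesis
      using True by (simp add: distrib_left distrib_right mult.assoc add_divide_distrib)
  next
    case False
    then show ?thesis using \<open>r \<ge> 0\<close> by (auto simp: indicator_def)
  qed
  have "(\<integral>\<^sup>+x. \<integral>\<^sup>+y. ennreal ((\<phi> x - \<phi> y)\<^sup>2) * indicator Q (x, y) \<partial>\<mu> \<partial>\<mu>)
    = (\<integral>\<^sup>+x. ennreal (exp (- V x)) * (\<integral>\<^sup>+y. ennreal (exp (- V y)) *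
        (ennreal ((\<phi> x - \<phi> y)\<^sup>2) * indicator Q (x, y)) \<partial>lborel) \<partial>lborel)"
    by (subst nn_integral_density, measurable, subst nn_integral_density, measurable)
  also have "\<dots> = (\<integral>\<^sup>+x. (\<integral>\<^sup>+y. ennreal (exp (- V x)) * (ennreal (exp (- V y)) *
        (ennreal ((\<phi> x - \<phi> y)\<^sup>2) * indicator Q (x, y))) \<partial>lborel) \<partial>lborel)"
    by (intro nn_integral_cong nn_integral_cmult[symmetric]) measurable
  also have "\<dots> \<le> (\<integral>\<^sup>+x. (\<integral>\<^sup>+y. ennreal r * ennreal (exp (- V x) * D \<phi> x y)
         + ennreal r * ennreal (exp (- V y) * D \<phi> x y) \<partial>lborel) \<partial>lborel)"
  proof (intro nn_integral_mono)
    fix x y :: 'a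
    have "ennreal (exp (- V x)) * (ennreal (exp (- V y)) *
        (ennreal ((\<phi> x - \<phi> y)\<^sup>2) * indicator Q (x, y)))
       = ennreal (exp (- V x) * (exp (- V y) * ((\<phi> x - \<phi> y)\<^sup>2 * indicator Q (x, y))))"
      by (simp add: ennreal_mult'' ennreal_indicator[symmetric])
    also have "\<dots> \<le> ennreal (r * (exp (- V x) * D \<phi> x y) + r * (exp (- V y) * D \<phi> x y))"
      using point by (intro ennreal_leI)
    also have "\<dots> = ennreal r * ennreal (exp (- V x) * D \<phi> x y) + ennreal r * ennreal (exp (- V y) * D \<phi> x y)"
      using \<open>r \<ge> 0\<close> by (subst ennreal_plus) (simp_all only: ennreal_mult'[symmetric], simp_all)
    finally show "ennreal (exp (- V x)) * (ennreal (exp (- V y)) *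
        (ennreal ((\<phi> x - \<phi> y)\<^sup>2) * indicator Q (x, y))) \<le> \<dots>" .
  qed
  also have "\<dots> = ennreal r * dirichlet_form \<theta> \<mu> \<phi>
        + ennreal r * (\<integral>\<^sup>+x. \<integral>\<^sup>+y. ennreal (exp (- V y) * D \<phi> x y) \<partial>lborel \<partial>lborel)"
    by (simp add: dirichlet_form_eq' nn_integral_add nn_integral_cmult)
  also have "(\<integral>\<^sup>+x. \<integral>\<^sup>+y. ennreal (exp (- V y) * D \<phi> x y) \<partial>lborel \<partial>lborel) = dirichlet_form \<theta> \<mu> \<phi>"
    unfolding dirichlet_form_eq[OF assms(1)]
    by (subst lborel_pair.Fubini') (auto intro!: nn_integral_cong)
  also have "ennreal r * dirichlet_form \<theta> \<mu> \<phi> + ennreal r * dirichlet_form \<theta> \<mu> \<phi> =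
      ennreal (2 * r) * dirichlet_form \<theta> \<mu> \<phi>"
    using \<open>r \<ge> 0\<close> by (simp add: ennreal_mult mult_2[symmetric] mult.assoc)
  finally show ?thesis .
qed

lemma square_integrable_imp_integrable:
  fixes \<phi> :: "'a \<Rightarrow> real"
  assumes [measurable]: "\<phi> \<in> borel_measurable borel" and "integrable \<mu> (\<lambda>x. (\<phi> x)\<^sup>2)"
  shows "integrable \<mu> \<phi>"
proof (rule Bochner_Integration.integrable_bound[where f = "\<lambda>x. 1 + (\<phi> x)\<^sup>2"])
  show "integrable \<mu> (\<lambda>x. 1 + (\<phi> x)\<^sup>2)" using assms by auto
  have "\<bar>t\<bar> \<le> 1 + t\<^sup>2" for t :: real
    using sum_squares_bound[of "\<bar>t\<bar>" 1] by (simp add: power2_eq_square)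
  then show "AE x in \<mu>. norm (\<phi> x) \<le> norm (1 + (\<phi> x)\<^sup>2)" by simp
qed simp

text \<open>Decomposition around the mean. With \<open>c = \<phi> x\<close> and integrated over
  \<open>x\<close>, it gives twice the variance; with the variance dropped, it bounds the distance
  of \<open>\<phi> x\<close> from the mean by differences of values.\<close>

lemma inner_square_integral:
  fixes \<phi> :: "'a \<Rightarrow> real"
  assumes [measurable]: "\<phi> \<in> borel_measurable borel" and sq: "integrable \<mu> (\<lambda>x. (\<phi> x)\<^sup>2)"
  shows "(\<integral>\<^sup>+y. ennreal ((c - \<phi> y)\<^sup>2) \<partial>\<mu>)
    = ennreal ((c - (LINT y|\<mu>. \<phi> y))\<^sup>2) + ennreal (LINT x|\<mu>. (\<phi> x - (LINT y|\<mu>. \<phi> y))\<^sup>2)"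
proof -
  have int: "integrable \<mu> \<phi>" by (rule square_integrable_imp_integrable) fact+
  define m where "m = (LINT y|\<mu>. \<phi> y)"
  have m: "(LINT y|\<mu>. \<phi> y) = m" "measure \<mu> UNIV = 1"
    using prob_space by (simp_all add: m_def)
  have i: "integrable \<mu> (\<lambda>y. (c - \<phi> y)\<^sup>2)" for c
    using int sq by (simp add: power2_diff)
  have e: "(LINT y|\<mu>. (c - \<phi> y)\<^sup>2) = c\<^sup>2 - 2 * c * m + (LINT y|\<mu>. (\<phi> y)\<^sup>2)" for c
    using int sq by (simp add: power2_diff m)
  have "(LINT y|\<mu>. (c - \<phi> y)\<^sup>2) = (c - m)\<^sup>2 + (LINT x|\<mu>. (m - \<phi> x)\<^sup>2)"
    unfolding e by (simp add: power2_eq_square algebra_simps)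
  then show ?thesis
    using i by (simp add: nn_integral_eq_integral m power2_commute[of _ m]
        flip: ennreal_plus)
qed

lemma double_square_integral:
  fixes \<phi> :: "'a \<Rightarrow> real"
  assumes [measurable]: "\<phi> \<in> borel_measurable borel" and sq: "integrable \<mu> (\<lambda>x. (\<phi> x)\<^sup>2)"
  shows "(\<integral>\<^sup>+x. \<integral>\<^sup>+y. ennreal ((\<phi> x - \<phi> y)\<^sup>2) \<partial>\<mu> \<partial>\<mu>)
    = 2 * ennreal (LINT x|\<mu>. (\<phi> x - (LINT y|\<mu>. \<phi> y))\<^sup>2)"
proof -
  have int: "integrable \<mu> \<phi>" by (rule square_integrable_imp_integrable) fact+
  have "integrable \<mu> (\<lambda>x. (\<phi> x - (LINT y|\<mu>. \<phi> y))\<^sup>2)"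
    using int sq by (simp add: power2_diff)
  then show ?thesis
    unfolding inner_square_integral[OF assms]
    by (simp add: nn_integral_add nn_integral_eq_integral emeasure_space_1[simplified] mult_2)
qed

lemma variance_le_dirichlet:
  fixes \<phi> :: "'a \<Rightarrow> real"
  assumes [measurable]: "\<phi> \<in> borel_measurable borel" and sq: "integrable \<mu> (\<lambda>x. (\<phi> x)\<^sup>2)"
    and "r \<ge> 0" and "\<And>x y. norm (x - y) powr (real DIM('a) + \<theta>) \<le> r * (exp (V x) + exp (V y))"
  shows "ennreal (LINT x|\<mu>. (\<phi> x - (LINT y|\<mu>. \<phi> y))\<^sup>2) \<le> ennreal r * dirichlet_form \<theta> \<mu> \<phi>"
proof -
  have [measurable]: "UNIV \<in> sets (borel \<Otimes>\<^sub>M borel :: ('a \<times> 'a) measure)"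
    by (metis sets.top space_pair_measure space_borel UNIV_Times_UNIV)
  have "2 * ennreal (LINT x|\<mu>. (\<phi> x - (LINT y|\<mu>. \<phi> y))\<^sup>2) \<le> 2 * (ennreal r * dirichlet_form \<theta> \<mu> \<phi>)"
    using kernel_comparison[of \<phi> UNIV r] assms
    by (simp add: double_square_integral ennreal_mult mult.assoc)
  then show ?thesis
    by (subst (asm) ennreal_mult_le_mult_iff) auto
qed

lemma square_le_variance:
  fixes \<phi> :: "'a \<Rightarrow> real"
  assumes [measurable]: "\<phi> \<in> borel_measurable borel" and sq: "integrable \<mu> (\<lambda>x. (\<phi> x)\<^sup>2)"
  shows "(LINT x|\<mu>. (\<phi> x)\<^sup>2) \<le> (LINT x|\<mu>. (\<phi> x - (LINT y|\<mu>. \<phi> y))\<^sup>2) + (LINT x|\<mu>. \<bar>\<phi> x\<bar>)\<^sup>2"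
proof -
  have int: "integrable \<mu> \<phi>" by (rule square_integrable_imp_integrable) fact+
  define m where "m = (LINT y|\<mu>. \<phi> y)"
  have m: "(LINT y|\<mu>. \<phi> y) = m" "measure \<mu> UNIV = 1"
    using prob_space by (simp_all add: m_def)
  have "(LINT y|\<mu>. (\<phi> y - m)\<^sup>2) = (LINT y|\<mu>. (\<phi> y)\<^sup>2) - m\<^sup>2"
    using int sq by (simp add: power2_diff m) (simp add: power2_eq_square)
  moreover have "\<bar>m\<bar> \<le> (LINT x|\<mu>. \<bar>\<phi> x\<bar>)" unfolding m_def by (rule integral_abs_bound)
  then have "m\<^sup>2 \<le> (LINT x|\<mu>. \<bar>\<phi> x\<bar>)\<^sup>2" by (metis abs_ge_zero power2_abs power_mono)
  ultimately show ?thesis by (simp add: m_def)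
qed

end

section \<open>Square integrals outside a ball and, by averaging, inside it\<close>

text \<open>Completing the square costs a quarter of \<open>a\<^sup>2\<close>. Integration then
  gives \<open>3/4 * v * a\<^sup>2 \<le> I + \<bar>a\<bar> * J\<close> for the two integrals
  \<open>I\<close> and \<open>J\<close>, and
  \<open>\<bar>a\<bar> * J \<le> v * a\<^sup>2 / 4 + J\<^sup>2 / v\<close> leaves half of
  \<open>v * a\<^sup>2\<close> on the left.\<close>

lemma average_square_bound:
  fixes \<phi> :: "'a::euclidean_space \<Rightarrow> real" and a v :: real
  assumes [measurable]: "\<phi> \<in> borel_measurable borel" "N \<in> sets borel"
    and "v > 0" and N: "emeasure lborel N = ennreal v"
  shows "ennreal (v * a\<^sup>2) \<le> 2 * (\<integral>\<^sup>+y\<in>N. ennreal ((a - \<phi> y)\<^sup>2) \<partial>lborel)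
    + ennreal (2 / v) * (\<integral>\<^sup>+y\<in>N. ennreal \<bar>\<phi> y\<bar> \<partial>lborel)\<^sup>2"
    (is "_ \<le> 2 * ?I + _ * ?J\<^sup>2")
proof (cases "?I = \<infinity> \<or> ?J = \<infinity>")
  case True
  then show ?thesis
    using \<open>v > 0\<close> by (auto simp: ennreal_mult_eq_top_iff power_eq_top_ennreal)
next
  case False
  then have fin: "?I < top" "?J < top" by (simp_all add: less_top)
  obtain i j where i: "?I = ennreal i" "i \<ge> 0" and j: "?J = ennreal j" "j \<ge> 0"
    using ennreal_enn2real[OF fin(1), symmetric] ennreal_enn2real[OF fin(2), symmetric] enn2real_nonneg
    by blast
  have point: "3 / 4 * a\<^sup>2 \<le> (a - \<phi> y)\<^sup>2 + \<bar>a\<bar> * \<bar>\<phi> y\<bar>" for y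
  proof -
    have "0 \<le> (\<bar>a\<bar> / 2 - \<bar>\<phi> y\<bar>)\<^sup>2" by simp
    also have "\<dots> = a\<^sup>2 / 4 - \<bar>a\<bar> * \<bar>\<phi> y\<bar> + (\<phi> y)\<^sup>2"
      by (simp add: power2_diff power_divide)
    finally have "0 \<le> a\<^sup>2 / 4 - \<bar>a\<bar> * \<bar>\<phi> y\<bar> + (\<phi> y)\<^sup>2" .
    moreover have "(a - \<phi> y)\<^sup>2 = a\<^sup>2 - 2 * (a * \<phi> y) + (\<phi> y)\<^sup>2" by (simp add: power2_diff)
    moreover have "a * \<phi> y \<le> \<bar>a\<bar> * \<bar>\<phi> y\<bar>" by (metis abs_ge_self abs_mult)
    ultimately show ?thesis by argo
  qed
  have "ennreal (3 / 4 * a\<^sup>2 * v) = (\<integral>\<^sup>+y\<in>N. ennreal (3 / 4 * a\<^sup>2) \<partial>lborel)"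
    using \<open>v > 0\<close> by (simp add: nn_integral_cmult_indicator N ennreal_mult[symmetric])
  also have "\<dots> \<le> (\<integral>\<^sup>+y. ennreal ((a - \<phi> y)\<^sup>2) * indicator N y +
      ennreal \<bar>a\<bar> * (ennreal \<bar>\<phi> y\<bar> * indicator N y) \<partial>lborel)"
  proof (intro nn_integral_mono)
    fix y
    have "ennreal (3 / 4 * a\<^sup>2) \<le> ennreal ((a - \<phi> y)\<^sup>2) + ennreal \<bar>a\<bar> * ennreal \<bar>\<phi> y\<bar>"
      using ennreal_leI[OF point[of y]] by (simp add: ennreal_mult)
    then show "ennreal (3 / 4 * a\<^sup>2) * indicator N y \<le> ennreal ((a - \<phi> y)\<^sup>2) * indicator N y +
      ennreal \<bar>a\<bar> * (ennreal \<bar>\<phi> y\<bar> * indicator N y)"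
      by (auto simp: indicator_def)
  qed
  also have "\<dots> = ennreal (i + \<bar>a\<bar> * j)"
    using i j by (simp add: nn_integral_add nn_integral_cmult ennreal_mult)
  finally have "3 / 4 * a\<^sup>2 * v \<le> i + \<bar>a\<bar> * j"
    using i j by (subst (asm) ennreal_le_iff) auto
  moreover have "\<bar>a\<bar> * j \<le> v * a\<^sup>2 / 4 + j\<^sup>2 / v"
  proof -
    have "0 \<le> (v * \<bar>a\<bar> / 2 - j)\<^sup>2 / v" using \<open>v > 0\<close> by simp
    also have "\<dots> = v * a\<^sup>2 / 4 - \<bar>a\<bar> * j + j\<^sup>2 / v"
      using \<open>v > 0\<close> by (simp add: power2_diff power_divide power_mult_distrib field_simps power2_eq_square)
    finally show ?thesis by simp
  qed
  ultimately have "v * a\<^sup>2 \<le> 2 * i + 2 / v * j\<^sup>2" by (simp add: algebra_simps)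
  then have "ennreal (v * a\<^sup>2) \<le> ennreal (2 * i + 2 / v * j\<^sup>2)" by (rule ennreal_leI)
  also have "\<dots> = 2 * ennreal i + ennreal (2 / v) * (ennreal j)\<^sup>2"
  proof -
    have "ennreal (2 / v * j\<^sup>2) = ennreal (2 / v) * (ennreal j)\<^sup>2"
      using j \<open>v > 0\<close> by (subst ennreal_mult) (auto simp: ennreal_power)
    moreover have "ennreal (2 * i) = 2 * ennreal i"
      using i by (subst ennreal_mult) auto
    moreover have "ennreal (2 * i + 2 / v * j\<^sup>2) = ennreal (2 * i) + ennreal (2 / v * j\<^sup>2)"
      using i j \<open>v > 0\<close> by (intro ennreal_plus) auto
    ultimately show ?thesis by simp
  qed
  finally show ?thesis
    unfolding i j .
qed

context gibbs_potential
begin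

lemma dirichlet_form_eq_density:
  fixes \<phi> :: "'a \<Rightarrow> real"
  assumes [measurable]: "\<phi> \<in> borel_measurable borel"
  shows "dirichlet_form \<theta> \<mu> \<phi> = (\<integral>\<^sup>+x. \<integral>\<^sup>+y. ennreal (D \<phi> x y) \<partial>lborel \<partial>\<mu>)"
  unfolding dirichlet_form_def
  by (intro nn_integral_cong) (auto simp: indicator_def norm_minus_commute power2_commute)

text \<open>For the mean \<open>m\<close>, \<open>(\<phi> x - m)\<^sup>2\<close> is at most the
  average of \<open>(\<phi> x - \<phi> y)\<^sup>2\<close> over all \<open>y\<close>. So only
  \<open>x\<close> has to lie outside the ball, while \<open>y\<close> is arbitrary. Splitting off
  \<open>m\<close> doubles the terms and leaves \<open>m\<^sup>2\<close>, which is at most the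
  squared mean of \<open>\<bar>\<phi>\<bar>\<close>.\<close>

lemma outer_square_integral:
  fixes \<phi> :: "'a \<Rightarrow> real"
  assumes [measurable]: "\<phi> \<in> borel_measurable borel" and sq: "integrable \<mu> (\<lambda>x. (\<phi> x)\<^sup>2)"
    and "r \<ge> 0"
    and far: "\<And>x y. norm x > t \<Longrightarrow> norm (x - y) powr (real DIM('a) + \<theta>) \<le> r * (exp (V x) + exp (V y))"
  shows "(\<integral>\<^sup>+x. ennreal ((\<phi> x)\<^sup>2) * indicator {x. norm x > t} x \<partial>\<mu>)
    \<le> ennreal (4 * r) * dirichlet_form \<theta> \<mu> \<phi> + ennreal (2 * (LINT x|\<mu>. \<bar>\<phi> x\<bar>)\<^sup>2)"
proof -
  define m where "m = (LINT y|\<mu>. \<phi> y)"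
  define l where "l = (LINT x|\<mu>. \<bar>\<phi> x\<bar>)"
  have "\<bar>m\<bar> \<le> l" unfolding m_def l_def by (rule integral_abs_bound)
  then have ml: "m\<^sup>2 \<le> l\<^sup>2" by (metis abs_ge_zero power2_abs power_mono)
  define S where "S = {x::'a. norm x > t}"
  have [measurable]: "S \<in> sets borel" unfolding S_def by measurable
  have Q [measurable]: "S \<times> UNIV \<in> sets (borel \<Otimes>\<^sub>M borel :: ('a \<times> 'a) measure)"
    by (rule pair_measureI) auto
  have "(\<integral>\<^sup>+x. ennreal ((\<phi> x)\<^sup>2) * indicator S x \<partial>\<mu>)
      \<le> (\<integral>\<^sup>+x. 2 * (ennreal ((\<phi> x - m)\<^sup>2) * indicator S x) + ennreal (2 * l\<^sup>2) \<partial>\<mu>)"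
  proof (intro nn_integral_mono)
    fix x
    have "(\<phi> x)\<^sup>2 \<le> 2 * (\<phi> x - m)\<^sup>2 + 2 * l\<^sup>2"
      using square_add_le[of "\<phi> x - m" m] ml by simp
    then have "ennreal ((\<phi> x)\<^sup>2) \<le> ennreal (2 * (\<phi> x - m)\<^sup>2 + 2 * l\<^sup>2)" by (rule ennreal_leI)
    also have "\<dots> = 2 * ennreal ((\<phi> x - m)\<^sup>2) + ennreal (2 * l\<^sup>2)"
      by (subst ennreal_plus) (auto simp: ennreal_mult)
    finally show "ennreal ((\<phi> x)\<^sup>2) * indicator S x
        \<le> 2 * (ennreal ((\<phi> x - m)\<^sup>2) * indicator S x) + ennreal (2 * l\<^sup>2)"
      by (auto simp: indicator_def)
  qed
  also have "\<dots> = 2 * (\<integral>\<^sup>+x. ennreal ((\<phi> x - m)\<^sup>2) * indicator S x \<partial>\<mu>) + ennreal (2 * l\<^sup>2)"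
    by (simp add: nn_integral_add nn_integral_cmult emeasure_space_1[simplified])
  also have "(\<integral>\<^sup>+x. ennreal ((\<phi> x - m)\<^sup>2) * indicator S x \<partial>\<mu>)
      \<le> (\<integral>\<^sup>+x. \<integral>\<^sup>+y. ennreal ((\<phi> x - \<phi> y)\<^sup>2) * indicator (S \<times> UNIV) (x, y) \<partial>\<mu> \<partial>\<mu>)"
  proof (intro nn_integral_mono)
    fix x
    have "ennreal ((\<phi> x - m)\<^sup>2) \<le> (\<integral>\<^sup>+y. ennreal ((\<phi> x - \<phi> y)\<^sup>2) \<partial>\<mu>)"
      using inner_square_integral[OF assms(1) sq] by (simp add: m_def)
    then show "ennreal ((\<phi> x - m)\<^sup>2) * indicator S x
        \<le> (\<integral>\<^sup>+y. ennreal ((\<phi> x - \<phi> y)\<^sup>2) * indicator (S \<times> UNIV) (x, y) \<partial>\<mu>)"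
      by (auto simp: indicator_def)
  qed
  also have "\<dots> \<le> ennreal (2 * r) * dirichlet_form \<theta> \<mu> \<phi>"
    using far \<open>r \<ge> 0\<close> by (intro kernel_comparison) (auto simp: S_def)
  also have "2 * (ennreal (2 * r) * dirichlet_form \<theta> \<mu> \<phi>) = ennreal (4 * r) * dirichlet_form \<theta> \<mu> \<phi>"
    using \<open>r \<ge> 0\<close> by (simp add: ennreal_mult mult.assoc[symmetric])
  finally show ?thesis
    by (simp add: S_def l_def add_mono mult_left_mono)
qed

text \<open>Each \<open>x\<close> in the ball of radius \<open>t\<close> is compared with the average of \<open>\<phi>\<close> over a ball of radius
  \<open>u / 2\<close> whose center is shifted towards the origin, so that the averaging stays in the ball of
  radius \<open>t\<close> and the bound \<open>M\<close> on \<open>exp V\<close> is not needed outside.\<close>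

lemma inner_square_integral_ball:
  fixes \<phi> :: "'a \<Rightarrow> real"
  assumes [measurable]: "\<phi> \<in> borel_measurable borel" and int: "integrable \<mu> \<phi>"
    and "t > 0" "0 < u" "u \<le> 2 * t"
    and M: "\<And>x. norm x \<le> t \<Longrightarrow> exp (V x) \<le> M"
    and v: "v = unit_ball_vol (real DIM('a)) * (u / 2) ^ DIM('a)"
  shows "(\<integral>\<^sup>+x. ennreal ((\<phi> x)\<^sup>2) * indicator {x. norm x \<le> t} x \<partial>\<mu>)
    \<le> ennreal (2 * u powr (real DIM('a) + \<theta>) / v) * dirichlet_form \<theta> \<mu> \<phi>
      + ennreal (2 * (M / v)\<^sup>2 * (LINT x|\<mu>. \<bar>\<phi> x\<bar>)\<^sup>2)"
proof -
  define l where "l = (LINT x|\<mu>. \<bar>\<phi> x\<bar>)"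
  \<comment> \<open>Chosen so that \<open>lam * t + u / 2 = t\<close>, which keeps the shifted ball
    within radius \<open>t\<close>. The shift and the radius of the ball each use at most half of
    the allowed distance \<open>u\<close>; \<open>u \<le> 2 * t\<close> gives
    \<open>lam \<ge> 0\<close>.\<close>
  define lam where "lam = 1 - u / (2 * t)"
  have lam: "0 \<le> lam" "1 - lam \<ge> 0" "(1 - lam) * t = u / 2"
    using \<open>t > 0\<close> \<open>0 < u\<close> \<open>u \<le> 2 * t\<close> by (simp_all add: lam_def)
  then have lam_t: "lam * t + u / 2 = t" by (simp add: left_diff_distrib)
  have "v > 0" using \<open>u > 0\<close> by (simp add: v)
  have "M > 0" using M[of 0] \<open>t > 0\<close> by (metis exp_gt_zero less_le_trans less_imp_le norm_zero)
  define N where "N x = cball (lam *\<^sub>R x) (u / 2)" for x :: 'a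
  have [measurable]: "N x \<in> sets borel" for x by (simp add: N_def)
  have N: "emeasure lborel (N x) = ennreal v" for x
    using \<open>u > 0\<close> by (simp add: N_def emeasure_cball v)
  have N_in: "norm y \<le> t" "norm (x - y) \<le> u" if "y \<in> N x" "norm x \<le> t" for x y
  proof -
    have y: "norm (lam *\<^sub>R x - y) \<le> u / 2" using that by (simp add: N_def dist_norm)
    have "norm (lam *\<^sub>R x) \<le> lam * t" using that lam by (simp add: mult_left_mono)
    moreover have "norm y \<le> norm (lam *\<^sub>R x) + norm (lam *\<^sub>R x - y)"
      by (metis add.commute norm_minus_commute norm_triangle_sub)
    ultimately show "norm y \<le> t" using y lam_t by linarith
    have "norm ((1 - lam) *\<^sub>R x) \<le> u / 2" using that lam by (metis norm_scaleR abs_of_nonneg mult_left_mono)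
    moreover have "norm (x - y) \<le> norm ((1 - lam) *\<^sub>R x) + norm (lam *\<^sub>R x - y)"
      using norm_triangle_ineq[of "(1 - lam) *\<^sub>R x" "lam *\<^sub>R x - y"] by (simp add: algebra_simps)
    ultimately show "norm (x - y) \<le> u" using y by linarith
  qed
  \<comment> \<open>Where \<open>exp (V y) \<le> M\<close>, one has
    \<open>1 \<le> M * exp (- V y)\<close>: Lebesgue measure is traded for \<open>\<mu>\<close> at
    the price \<open>M\<close>.\<close>
  have J: "(\<integral>\<^sup>+y\<in>N x. ennreal \<bar>\<phi> y\<bar> \<partial>lborel) \<le> ennreal (M * l)" if "norm x \<le> t" for x
  proof -
    have "(\<integral>\<^sup>+y\<in>N x. ennreal \<bar>\<phi> y\<bar> \<partial>lborel) \<le> (\<integral>\<^sup>+y. ennreal M * (ennreal (exp (- V y)) * ennreal \<bar>\<phi> y\<bar>) \<partial>lborel)"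
    proof (intro nn_integral_mono)
      fix y
      have "ennreal \<bar>\<phi> y\<bar> \<le> ennreal M * (ennreal (exp (- V y)) * ennreal \<bar>\<phi> y\<bar>)" if "y \<in> N x"
      proof -
        have "1 * \<bar>\<phi> y\<bar> \<le> M * exp (- V y) * \<bar>\<phi> y\<bar>"
          using M[OF N_in(1)[OF that \<open>norm x \<le> t\<close>]]
          by (intro mult_right_mono) (auto simp: exp_minus field_simps)
        then show ?thesis
          using \<open>M > 0\<close> by (simp add: ennreal_mult[symmetric] ac_simps)
      qed
      then show "ennreal \<bar>\<phi> y\<bar> * indicator (N x) y \<le> ennreal M * (ennreal (exp (- V y)) * ennreal \<bar>\<phi> y\<bar>)"
        by (auto simp: indicator_def)
    qed
    also have "\<dots> = ennreal M * (\<integral>\<^sup>+y. ennreal \<bar>\<phi> y\<bar> \<partial>\<mu>)"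
      by (simp add: nn_integral_cmult nn_integral_density)
    also have "(\<integral>\<^sup>+y. ennreal \<bar>\<phi> y\<bar> \<partial>\<mu>) = ennreal l"
      using int by (simp add: l_def nn_integral_eq_integral)
    finally show ?thesis using \<open>M > 0\<close> by (simp add: ennreal_mult')
  qed
  have I: "(\<integral>\<^sup>+y\<in>N x. ennreal ((\<phi> x - \<phi> y)\<^sup>2) \<partial>lborel)
      \<le> ennreal (u powr (real DIM('a) + \<theta>)) * (\<integral>\<^sup>+y. ennreal (D \<phi> x y) \<partial>lborel)" if "norm x \<le> t" for x
  proof -
    have "(\<integral>\<^sup>+y\<in>N x. ennreal ((\<phi> x - \<phi> y)\<^sup>2) \<partial>lborel)
       \<le> (\<integral>\<^sup>+y. ennreal (u powr (real DIM('a) + \<theta>)) * ennreal (D \<phi> x y) \<partial>lborel)"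
    proof (intro nn_integral_mono)
      fix y
      have "(\<phi> x - \<phi> y)\<^sup>2 \<le> u powr (real DIM('a) + \<theta>) * D \<phi> x y" if "y \<in> N x"
      proof (cases "x = y")
        case False
        have "norm (x - y) powr (real DIM('a) + \<theta>) \<le> u powr (real DIM('a) + \<theta>)"
          using N_in(2)[OF that \<open>norm x \<le> t\<close>] \<theta>_pos by (intro powr_mono2) auto
        then have "norm (x - y) powr (real DIM('a) + \<theta>) * D \<phi> x y \<le> u powr (real DIM('a) + \<theta>) * D \<phi> x y"
          by (intro mult_right_mono) auto
        then show ?thesis using False by simp
      qed simp
      then show "ennreal ((\<phi> x - \<phi> y)\<^sup>2) * indicator (N x) y
          \<le> ennreal (u powr (real DIM('a) + \<theta>)) * ennreal (D \<phi> x y)"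
        by (auto simp: indicator_def ennreal_mult'[symmetric] intro!: ennreal_leI simp del: times_divide_eq_right)
    qed
    then show ?thesis by (simp add: nn_integral_cmult)
  qed
  let ?U = "ennreal (u powr (real DIM('a) + \<theta>))"
  have "ennreal v * (\<integral>\<^sup>+x. ennreal ((\<phi> x)\<^sup>2) * indicator {x. norm x \<le> t} x \<partial>\<mu>)
      = (\<integral>\<^sup>+x. ennreal v * (ennreal ((\<phi> x)\<^sup>2) * indicator {x. norm x \<le> t} x) \<partial>\<mu>)"
    by (intro nn_integral_cmult[symmetric]) measurable
  also have "\<dots> \<le> (\<integral>\<^sup>+x. 2 * ?U * (\<integral>\<^sup>+y. ennreal (D \<phi> x y) \<partial>lborel)
        + ennreal (2 / v) * (ennreal (M * l))\<^sup>2 \<partial>\<mu>)"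
  proof (intro nn_integral_mono)
    fix x
    show "ennreal v * (ennreal ((\<phi> x)\<^sup>2) * indicator {x. norm x \<le> t} x)
      \<le> 2 * ?U * (\<integral>\<^sup>+y. ennreal (D \<phi> x y) \<partial>lborel) + ennreal (2 / v) * (ennreal (M * l))\<^sup>2"
    proof (cases "norm x \<le> t")
      case True
      have "ennreal v * ennreal ((\<phi> x)\<^sup>2) \<le> 2 * (\<integral>\<^sup>+y\<in>N x. ennreal ((\<phi> x - \<phi> y)\<^sup>2) \<partial>lborel)
          + ennreal (2 / v) * (\<integral>\<^sup>+y\<in>N x. ennreal \<bar>\<phi> y\<bar> \<partial>lborel)\<^sup>2"
        using average_square_bound[of \<phi> "N x" v "\<phi> x"] \<open>v > 0\<close> N by (simp add: ennreal_mult)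
      also have "\<dots> \<le> 2 * (?U * (\<integral>\<^sup>+y. ennreal (D \<phi> x y) \<partial>lborel)) + ennreal (2 / v) * (ennreal (M * l))\<^sup>2"
        using True I J by (intro add_mono mult_left_mono power_mono_ennreal) auto
      finally show ?thesis using True by (simp add: mult.assoc)
    qed simp
  qed
  also have "\<dots> = 2 * ?U * dirichlet_form \<theta> \<mu> \<phi> + ennreal (2 / v) * (ennreal (M * l))\<^sup>2"
    by (simp add: dirichlet_form_eq_density nn_integral_add nn_integral_cmult emeasure_space_1[simplified])
  finally have "ennreal (1 / v) * (ennreal v * (\<integral>\<^sup>+x. ennreal ((\<phi> x)\<^sup>2) * indicator {x. norm x \<le> t} x \<partial>\<mu>))
      \<le> ennreal (1 / v) * (2 * ?U * dirichlet_form \<theta> \<mu> \<phi> + ennreal (2 / v) * (ennreal (M * l))\<^sup>2)"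
    by (rule mult_left_mono) simp
  also have "\<dots> = ennreal (1 / v) * (2 * ?U) * dirichlet_form \<theta> \<mu> \<phi> +
      ennreal (1 / v) * (ennreal (2 / v) * (ennreal (M * l))\<^sup>2)"
    by (simp add: distrib_left mult.assoc)
  also have "ennreal (1 / v) * (2 * ?U) = ennreal (2 * u powr (real DIM('a) + \<theta>) / v)"
  proof -
    have "ennreal (2 * u powr (real DIM('a) + \<theta>) / v) = ennreal (1 / v * (2 * u powr (real DIM('a) + \<theta>)))"
      by simp
    also have "\<dots> = ennreal (1 / v) * (2 * ?U)"
      using \<open>v > 0\<close> by (subst ennreal_mult) (auto simp: ennreal_mult)
    finally show ?thesis by simp
  qed
  also have "ennreal (1 / v) * (ennreal (2 / v) * (ennreal (M * l))\<^sup>2) = ennreal (2 * (M / v)\<^sup>2 * l\<^sup>2)"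
  proof -
    have "l \<ge> 0" by (simp add: l_def)
    have "2 * (M / v)\<^sup>2 * l\<^sup>2 = 1 / v * (2 / v * (M * l)\<^sup>2)"
      by (simp add: power2_eq_square)
    also have "ennreal \<dots> = ennreal (1 / v) * (ennreal (2 / v) * ennreal ((M * l)\<^sup>2))"
      using \<open>v > 0\<close> by (subst ennreal_mult, simp, simp, subst ennreal_mult) auto
    finally show ?thesis
      using \<open>l \<ge> 0\<close> \<open>M > 0\<close> by (simp add: ennreal_power)
  qed
  also have "ennreal (1 / v) * (ennreal v * (\<integral>\<^sup>+x. ennreal ((\<phi> x)\<^sup>2) * indicator {x. norm x \<le> t} x \<partial>\<mu>))
      = (\<integral>\<^sup>+x. ennreal ((\<phi> x)\<^sup>2) * indicator {x. norm x \<le> t} x \<partial>\<mu>)"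
    using \<open>v > 0\<close> by (simp add: mult.assoc[symmetric] ennreal_mult'[symmetric])
  finally show ?thesis by (simp add: l_def)
qed

lemma super_poincare_estimate:
  fixes \<phi> :: "'a \<Rightarrow> real"
  assumes [measurable]: "\<phi> \<in> borel_measurable borel" and sq: "integrable \<mu> (\<lambda>x. (\<phi> x)\<^sup>2)"
    and "r \<ge> 0"
    and far: "\<And>x y. norm x > t \<Longrightarrow> norm (x - y) powr (real DIM('a) + \<theta>) \<le> r * (exp (V x) + exp (V y))"
    and "t > 0" "0 < u" "u \<le> 2 * t"
    and M: "\<And>x. norm x \<le> t \<Longrightarrow> exp (V x) \<le> M"
    and v: "v = unit_ball_vol (real DIM('a)) * (u / 2) ^ DIM('a)"
  shows "ennreal (LINT x|\<mu>. (\<phi> x)\<^sup>2)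
    \<le> ennreal (4 * r + 2 * u powr (real DIM('a) + \<theta>) / v) * dirichlet_form \<theta> \<mu> \<phi>
      + ennreal (2 + 2 * (M / v)\<^sup>2) * ennreal ((LINT x|\<mu>. \<bar>\<phi> x\<bar>)\<^sup>2)"
proof -
  have "v > 0" using \<open>u > 0\<close> by (simp add: v)
  note int = square_integrable_imp_integrable[OF assms(1) sq]
  define l where "l = (LINT x|\<mu>. \<bar>\<phi> x\<bar>)"
  have "ennreal (LINT x|\<mu>. (\<phi> x)\<^sup>2) = (\<integral>\<^sup>+x. ennreal ((\<phi> x)\<^sup>2) \<partial>\<mu>)"
    using sq by (simp add: nn_integral_eq_integral)
  also have "\<dots> = (\<integral>\<^sup>+x. ennreal ((\<phi> x)\<^sup>2) * indicator {x. norm x > t} x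
      + ennreal ((\<phi> x)\<^sup>2) * indicator {x. norm x \<le> t} x \<partial>\<mu>)"
    by (intro nn_integral_cong) (auto simp: indicator_def)
  also have "\<dots> = (\<integral>\<^sup>+x. ennreal ((\<phi> x)\<^sup>2) * indicator {x. norm x > t} x \<partial>\<mu>)
      + (\<integral>\<^sup>+x. ennreal ((\<phi> x)\<^sup>2) * indicator {x. norm x \<le> t} x \<partial>\<mu>)"
    by (intro nn_integral_add) measurable
  also have "\<dots> \<le> (ennreal (4 * r) * dirichlet_form \<theta> \<mu> \<phi> + ennreal (2 * l\<^sup>2)) +
     (ennreal (2 * u powr (real DIM('a) + \<theta>) / v) * dirichlet_form \<theta> \<mu> \<phi> + ennreal (2 * (M / v)\<^sup>2 * l\<^sup>2))"
    unfolding l_def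
    by (intro add_mono outer_square_integral[OF assms(1) sq \<open>r \<ge> 0\<close> far]
        inner_square_integral_ball[OF assms(1) int \<open>t > 0\<close> \<open>0 < u\<close> \<open>u \<le> 2 * t\<close> M v])
  also have "\<dots> = (ennreal (4 * r) + ennreal (2 * u powr (real DIM('a) + \<theta>) / v)) * dirichlet_form \<theta> \<mu> \<phi>
       + (ennreal (2 * l\<^sup>2) + ennreal (2 * (M / v)\<^sup>2 * l\<^sup>2))"
    by (simp only: distrib_right) (simp only: ac_simps)
  also have "ennreal (4 * r) + ennreal (2 * u powr (real DIM('a) + \<theta>) / v) = ennreal (4 * r + 2 * u powr (real DIM('a) + \<theta>) / v)"
    using \<open>r \<ge> 0\<close> \<open>v > 0\<close> by (intro ennreal_plus[symmetric]) auto
  also have "ennreal (2 * l\<^sup>2) + ennreal (2 * (M / v)\<^sup>2 * l\<^sup>2) = ennreal (2 + 2 * (M / v)\<^sup>2) * ennreal (l\<^sup>2)"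
  proof -
    have "ennreal (2 * l\<^sup>2) + ennreal (2 * (M / v)\<^sup>2 * l\<^sup>2) = ennreal (2 * l\<^sup>2 + 2 * (M / v)\<^sup>2 * l\<^sup>2)"
      by (intro ennreal_plus[symmetric]) auto
    also have "2 * l\<^sup>2 + 2 * (M / v)\<^sup>2 * l\<^sup>2 = (2 + 2 * (M / v)\<^sup>2) * l\<^sup>2"
      by (rule distrib_right[symmetric])
    finally show ?thesis by (simp only: ennreal_mult'' zero_le_power2)
  qed
  finally show ?thesis by (simp add: l_def)
qed

section \<open>The weak Poincare inequality\<close>

text \<open>Continuity from above: the sets of pairs at distance more than \<open>n\<close> decrease
  to the empty set. This provides an admissible \<open>s\<close> in
  \<open>weak_rate\<close>.\<close>

lemma emeasure_far_pairs_le: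
  assumes "\<epsilon> > 0"
  shows "\<exists>s>0. emeasure (\<mu> \<Otimes>\<^sub>M \<mu>) {(x, y). norm (x - y) > s} \<le> ennreal \<epsilon>"
proof -
  interpret P: pair_prob_space \<mu> \<mu> ..
  define A where "A n = {(x::'a, y). norm (x - y) > real n}" for n
  have A_eq: "A n = {z \<in> space (borel \<Otimes>\<^sub>M borel). norm (fst z - snd z) > real n}" for n
    by (auto simp: A_def space_pair_measure)
  have A_sets: "A n \<in> sets (\<mu> \<Otimes>\<^sub>M \<mu>)" for n
  proof -
    have "A n \<in> sets (borel \<Otimes>\<^sub>M borel)" unfolding A_eq by measurable
    also have "sets (borel \<Otimes>\<^sub>M borel) = sets (\<mu> \<Otimes>\<^sub>M \<mu>)" by (intro sets_pair_measure_cong) auto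
    finally show ?thesis .
  qed
  have "(\<lambda>n. measure (\<mu> \<Otimes>\<^sub>M \<mu>) (A n)) \<longlonglongrightarrow> measure (\<mu> \<Otimes>\<^sub>M \<mu>) (\<Inter>n. A n)"
  proof (rule P.finite_Lim_measure_decseq)
    show "decseq A" by (auto simp: A_def decseq_def)
    show "range A \<subseteq> sets (\<mu> \<Otimes>\<^sub>M \<mu>)" using A_sets by blast
  qed
  moreover have "(\<Inter>n. A n) = {}"
  proof -
    have "z \<notin> (\<Inter>n. A n)" for z
    proof -
      obtain n where "norm (fst z - snd z) \<le> real n" using real_arch_simple by blast
      then have "z \<notin> A n" by (simp add: A_def split_beta)
      then show ?thesis by blast
    qed
    then show ?thesis by blast
  qed
  ultimately have "(\<lambda>n. measure (\<mu> \<Otimes>\<^sub>M \<mu>) (A n)) \<longlonglongrightarrow> 0" by simp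
  then have "eventually (\<lambda>n. measure (\<mu> \<Otimes>\<^sub>M \<mu>) (A n) < \<epsilon>) sequentially"
    using \<open>\<epsilon> > 0\<close> by (rule order_tendstoD)
  then obtain k where "measure (\<mu> \<Otimes>\<^sub>M \<mu>) (A (Suc k)) < \<epsilon>"
    unfolding eventually_sequentially by (meson le_SucI order_refl)
  then have "emeasure (\<mu> \<Otimes>\<^sub>M \<mu>) (A (Suc k)) \<le> ennreal \<epsilon>"
    unfolding P.emeasure_eq_measure by (intro ennreal_leI) simp
  then show ?thesis
    unfolding A_def by (intro exI[of _ "real (Suc k)"] conjI) simp_all
qed

text \<open>The lower bound on \<open>exp V\<close> makes the inner infimum positive and hence the
  rate finite. Near pairs obey the kernel comparison with constant \<open>1 / I s\<close>. On far
  pairs the squared difference is at most four times the squared essential supremum and their mass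
  is at most \<open>r / 2\<close>; since the double integral is twice the variance, this yields
  exactly \<open>r\<close>.\<close>

lemma weak_poincare_weak_rate:
  assumes "c > 0" and c: "\<And>x. c \<le> exp (V x)"
  shows "weak_poincare \<theta> \<mu> (weak_rate \<theta> V)"
  unfolding weak_poincare_def
proof (intro allI impI)
  fix r :: real assume "r > 0"
  let ?p = "real DIM('a) + \<theta>"
  define I where "I s = (INF (x, y)\<in>{(x, y). 0 < norm (x - y) \<and> norm (x - y) \<le> s}.
              ennreal ((exp (V x) + exp (V y)) * norm (x - y) powr - ?p))" for s
  define G where "G s = (\<integral>\<^sup>+x. (\<integral>\<^sup>+y\<in>{y. norm (x - y) > s}.
            ennreal (exp (- V x) * exp (- V y)) \<partial>lborel) \<partial>lborel)" for s
  define S where "S = {s. s > 0 \<and> G s \<le> ennreal (r / 2)}"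
  have W: "weak_rate \<theta> V r = (INF s\<in>S. 1 / I s)"
    unfolding weak_rate_def I_def S_def G_def ..
  have G: "G s = (\<integral>\<^sup>+x. \<integral>\<^sup>+y. indicator {(x, y). norm (x - y) > s} (x, y) \<partial>\<mu> \<partial>\<mu>)" for s
  proof -
    have [measurable]: "Measurable.pred (borel \<Otimes>\<^sub>M borel) (\<lambda>z::'a \<times> 'a. norm (fst z - snd z) > s)"
      by measurable
    have *: "(indicator {(x::'a, y). norm (x - y) > s} (x, y) :: ennreal) = indicator {y. norm (x - y) > s} y" for x y
      by (simp add: indicator_def)
    have "(\<integral>\<^sup>+x. \<integral>\<^sup>+y. indicator {(x, y). norm (x - y) > s} (x, y) \<partial>\<mu> \<partial>\<mu>)
      = (\<integral>\<^sup>+x. ennreal (exp (- V x)) * (\<integral>\<^sup>+y. ennreal (exp (- V y)) * indicator {y. norm (x - y) > s} y \<partial>lborel) \<partial>lborel)"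
      unfolding * by (subst nn_integral_density, measurable, subst nn_integral_density, measurable)
    also have "\<dots> = (\<integral>\<^sup>+x. (\<integral>\<^sup>+y. ennreal (exp (- V x)) * (ennreal (exp (- V y)) * indicator {y. norm (x - y) > s} y) \<partial>lborel) \<partial>lborel)"
      by (intro nn_integral_cong nn_integral_cmult[symmetric]) measurable
    finally show ?thesis
      by (simp add: G_def ennreal_mult mult.assoc)
  qed
  have pm [measurable]: "{(x::'a, y). norm (x - y) > s} \<in> sets (borel \<Otimes>\<^sub>M borel)"
    "{(x::'a, y). norm (x - y) \<le> s} \<in> sets (borel \<Otimes>\<^sub>M borel)" for s
  proof -
    have "{(x::'a, y). norm (x - y) > s} = {z \<in> space (borel \<Otimes>\<^sub>M borel). norm (fst z - snd z) > s}"
      "{(x::'a, y). norm (x - y) \<le> s} = {z \<in> space (borel \<Otimes>\<^sub>M borel). norm (fst z - snd z) \<le> s}"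
      by (auto simp: space_pair_measure)
    then show "{(x::'a, y). norm (x - y) > s} \<in> sets (borel \<Otimes>\<^sub>M borel)"
      "{(x::'a, y). norm (x - y) \<le> s} \<in> sets (borel \<Otimes>\<^sub>M borel)" by simp_all
  qed
  have G': "G s = emeasure (\<mu> \<Otimes>\<^sub>M \<mu>) {(x, y). norm (x - y) > s}" for s
    unfolding G by (rule emeasure_pair_measure[symmetric])
      (use pm(1)[of s] in \<open>simp add: sets_pair_measure_cong[of \<mu> borel \<mu> borel]\<close>)
  obtain s\<^sub>0 where "s\<^sub>0 \<in> S"
    using emeasure_far_pairs_le[of "r / 2"] \<open>r > 0\<close> unfolding S_def G' by auto
  have I_pos: "0 < I s" if "s > 0" for s
  proof -
    have "ennreal (2 * c * s powr - ?p) \<le> I s"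
      unfolding I_def
    proof (intro INF_greatest, clarify)
      fix x y :: 'a assume "0 < norm (x - y)" "norm (x - y) \<le> s"
      then have "s powr - ?p \<le> norm (x - y) powr - ?p"
        using \<theta>_pos by (intro powr_mono2') auto
      moreover have "2 * c \<le> exp (V x) + exp (V y)" using c[of x] c[of y] by simp
      ultimately show "ennreal (2 * c * s powr - ?p) \<le> ennreal ((exp (V x) + exp (V y)) * norm (x - y) powr - ?p)"
        using \<open>c > 0\<close> by (intro ennreal_leI mult_mono) auto
    qed
    then show ?thesis using \<open>c > 0\<close> \<open>s > 0\<close> by (auto intro: less_le_trans[rotated])
  qed
  \<comment> \<open>There are points of every norm \<open>s\<close>, so this infimum is over a
    nonempty set. An empty one would have infimum \<open>\<infinity>\<close> and make
    \<open>1 / I s\<close> zero.\<close>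
  have I_fin: "I s < \<infinity>" if "s > 0" for s
  proof -
    obtain e :: 'a where "norm e = s" using \<open>s > 0\<close> vector_choose_size[of s] by auto
    then have "I s \<le> ennreal ((exp (V e) + exp (V 0)) * norm (e - 0) powr - ?p)"
      unfolding I_def using \<open>s > 0\<close> by (intro INF_lower2[of "(e, 0)"]) auto
    then show ?thesis using le_less_trans by fastforce
  qed
  have fin: "weak_rate \<theta> V r < \<infinity>"
  proof -
    have "weak_rate \<theta> V r \<le> 1 / I s\<^sub>0" unfolding W using \<open>s\<^sub>0 \<in> S\<close> by (rule INF_lower)
    also have "\<dots> < \<infinity>"
      using I_pos[of s\<^sub>0] \<open>s\<^sub>0 \<in> S\<close> by (auto simp: S_def ennreal_divide_eq_top_iff less_top[symmetric])
    finally show ?thesis .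
  qed
  have main: "ennreal (LINT x|\<mu>. (\<phi> x - (LINT y|\<mu>. \<phi> y))\<^sup>2)
          \<le> weak_rate \<theta> V r * dirichlet_form \<theta> \<mu> \<phi> + ennreal r * (esssup \<mu> (\<lambda>x. ennreal \<bar>\<phi> x\<bar>))\<^sup>2"
    if \<phi>: "\<phi> \<in> dirichlet_domain \<theta> \<mu>" for \<phi>
  proof (cases "esssup \<mu> (\<lambda>x. ennreal \<bar>\<phi> x\<bar>) = \<infinity>")
    case True
    then show ?thesis using \<open>r > 0\<close> by (simp add: ennreal_mult_top)
  next
    case False
    have [measurable]: "\<phi> \<in> borel_measurable borel" and sq: "integrable \<mu> (\<lambda>x. (\<phi> x)\<^sup>2)"
      and E: "dirichlet_form \<theta> \<mu> \<phi> < \<infinity>"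
      using \<phi> by (auto simp: dirichlet_domain_def)
    obtain n where n: "esssup \<mu> (\<lambda>x. ennreal \<bar>\<phi> x\<bar>) = ennreal n" "n \<ge> 0"
      using False by (cases "esssup \<mu> (\<lambda>x. ennreal \<bar>\<phi> x\<bar>)") auto
    have AE: "AE x in \<mu>. \<bar>\<phi> x\<bar> \<le> n"
      using esssup_AE[of "\<lambda>x. ennreal \<bar>\<phi> x\<bar>" \<mu>] n by simp
    let ?V = "ennreal (LINT x|\<mu>. (\<phi> x - (LINT y|\<mu>. \<phi> y))\<^sup>2)"
    have "?V \<le> 1 / I s * dirichlet_form \<theta> \<mu> \<phi> + ennreal (r * n\<^sup>2)" if "s \<in> S" for s
    proof -
      have "s > 0" "G s \<le> ennreal (r / 2)" using that by (auto simp: S_def)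
      then obtain i where i: "I s = ennreal i" "i > 0"
        using I_pos[of s] I_fin[of s] by (cases "I s") auto
      have le: "norm (x - y) powr ?p \<le> 1 / i * (exp (V x) + exp (V y))" if "norm (x - y) \<le> s" for x y
      proof (cases "x = y")
        case False
        have "I s \<le> ennreal ((exp (V x) + exp (V y)) * norm (x - y) powr - ?p)"
          unfolding I_def using that False by (intro INF_lower2[of "(x, y)"]) auto
        then have "i \<le> (exp (V x) + exp (V y)) * norm (x - y) powr - ?p"
          unfolding i by (subst (asm) ennreal_le_iff) auto
        then have "i \<le> (exp (V x) + exp (V y)) * (1 / norm (x - y) powr ?p)"
          unfolding powr_minus_divide .
        moreover have "norm (x - y) powr ?p > 0" using False by simp
        ultimately show ?thesis using i by (simp add: field_simps)
      qed (use i \<theta>_pos in \<open>auto simp: add_pos_pos less_imp_le\<close>)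
      have near: "(\<integral>\<^sup>+x. \<integral>\<^sup>+y. ennreal ((\<phi> x - \<phi> y)\<^sup>2) * indicator {(x, y). norm (x - y) \<le> s} (x, y) \<partial>\<mu> \<partial>\<mu>)
        \<le> ennreal (2 * (1 / i)) * dirichlet_form \<theta> \<mu> \<phi>"
        using i le by (intro kernel_comparison) auto
      have far: "(\<integral>\<^sup>+x. \<integral>\<^sup>+y. ennreal ((\<phi> x - \<phi> y)\<^sup>2) * indicator {(x, y). norm (x - y) > s} (x, y) \<partial>\<mu> \<partial>\<mu>)
        \<le> ennreal (2 * (r * n\<^sup>2))"
      proof -
        have "(\<integral>\<^sup>+x. \<integral>\<^sup>+y. ennreal ((\<phi> x - \<phi> y)\<^sup>2) * indicator {(x, y). norm (x - y) > s} (x, y) \<partial>\<mu> \<partial>\<mu>)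
           \<le> (\<integral>\<^sup>+x. \<integral>\<^sup>+y. ennreal (4 * n\<^sup>2) * indicator {(x, y). norm (x - y) > s} (x, y) \<partial>\<mu> \<partial>\<mu>)"
        proof (rule nn_integral_mono_AE, use AE in eventually_elim, rule nn_integral_mono_AE, use AE in eventually_elim)
          fix x y assume "\<bar>\<phi> x\<bar> \<le> n" "\<bar>\<phi> y\<bar> \<le> n"
          then have "\<bar>\<phi> x - \<phi> y\<bar> \<le> \<bar>2 * n\<bar>" by linarith
          then have "(\<phi> x - \<phi> y)\<^sup>2 \<le> (2 * n)\<^sup>2" by (simp only: abs_le_square_iff)
          then show "ennreal ((\<phi> x - \<phi> y)\<^sup>2) * indicator {(x, y). norm (x - y) > s} (x, y)
             \<le> ennreal (4 * n\<^sup>2) * indicator {(x, y). norm (x - y) > s} (x, y)"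
            by (intro mult_right_mono ennreal_leI) auto
        qed
        also have "\<dots> = ennreal (4 * n\<^sup>2) * G s"
          unfolding G by (simp add: nn_integral_cmult)
        also have "\<dots> \<le> ennreal (4 * n\<^sup>2) * ennreal (r / 2)"
          using \<open>G s \<le> _\<close> by (rule mult_left_mono) simp
        also have "\<dots> = ennreal (2 * (r * n\<^sup>2))"
          using \<open>r > 0\<close> by (simp add: ennreal_mult[symmetric] ac_simps)
        finally show ?thesis .
      qed
      have "2 * ?V = (\<integral>\<^sup>+x. \<integral>\<^sup>+y. ennreal ((\<phi> x - \<phi> y)\<^sup>2) \<partial>\<mu> \<partial>\<mu>)"
        using double_square_integral[of \<phi>] sq by simp
      also have "\<dots> = (\<integral>\<^sup>+x. \<integral>\<^sup>+y. ennreal ((\<phi> x - \<phi> y)\<^sup>2) * indicator {(x, y). norm (x - y) \<le> s} (x, y)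
          + ennreal ((\<phi> x - \<phi> y)\<^sup>2) * indicator {(x, y). norm (x - y) > s} (x, y) \<partial>\<mu> \<partial>\<mu>)"
        by (intro nn_integral_cong) (auto simp: indicator_def)
      also have "\<dots> = (\<integral>\<^sup>+x. \<integral>\<^sup>+y. ennreal ((\<phi> x - \<phi> y)\<^sup>2) * indicator {(x, y). norm (x - y) \<le> s} (x, y) \<partial>\<mu> \<partial>\<mu>)
          + (\<integral>\<^sup>+x. \<integral>\<^sup>+y. ennreal ((\<phi> x - \<phi> y)\<^sup>2) * indicator {(x, y). norm (x - y) > s} (x, y) \<partial>\<mu> \<partial>\<mu>)"
        by (simp add: nn_integral_add)
      also have "\<dots> \<le> ennreal (2 * (1 / i)) * dirichlet_form \<theta> \<mu> \<phi> + ennreal (2 * (r * n\<^sup>2))"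
        by (intro add_mono near far)
      also have "\<dots> = 2 * (1 / I s * dirichlet_form \<theta> \<mu> \<phi> + ennreal (r * n\<^sup>2))"
      proof -
        have "ennreal (2 * (1 / i)) = 2 * (1 / I s)"
          unfolding i(1) using i(2) divide_ennreal[of 1 i] ennreal_mult[of 2 "1 / i"] by simp
        moreover have "ennreal (2 * (r * n\<^sup>2)) = 2 * ennreal (r * n\<^sup>2)"
          using \<open>r > 0\<close> by (subst ennreal_mult) auto
        ultimately show ?thesis by (simp add: distrib_left mult.assoc)
      qed
      finally show ?thesis
        by (subst (asm) ennreal_mult_le_mult_iff) auto
    qed
    then have "?V \<le> (INF s\<in>S. 1 / I s) * dirichlet_form \<theta> \<mu> \<phi> + ennreal (r * n\<^sup>2)"
      using \<open>s\<^sub>0 \<in> S\<close> E by (intro le_INF_mult_add) auto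
    then show ?thesis
      using n \<open>r > 0\<close> by (simp add: W ennreal_mult ennreal_power)
  qed
  show "weak_rate \<theta> V r < \<infinity> \<and>
       (\<forall>\<phi>\<in>dirichlet_domain \<theta> \<mu>.
          ennreal (LINT x|\<mu>. (\<phi> x - (LINT y|\<mu>. \<phi> y))\<^sup>2)
          \<le> weak_rate \<theta> V r * dirichlet_form \<theta> \<mu> \<phi> + ennreal r * (esssup \<mu> (\<lambda>x. ennreal \<bar>\<phi> x\<bar>))\<^sup>2)"
    using fin main by blast
qed

end

section \<open>Asymptotics of the profile\<close>

text \<open>The profile of \<open>omega\<close> without its constant, for
  \<open>\<kappa> = A / \<alpha> * b powr - (\<alpha> / \<beta>)\<close>,
  \<open>q = \<alpha> / \<beta>\<close> and \<open>m = B / \<beta>\<close>. In exponential form,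
  estimates become inequalities in \<open>l = ln \<rho>\<close>.\<close>

definition weight :: "real \<Rightarrow> real \<Rightarrow> real \<Rightarrow> real \<Rightarrow> real \<Rightarrow> real" where
  "weight \<kappa> q \<theta> m \<rho> = exp (\<kappa> * ln \<rho> powr q - \<theta> * ln \<rho>) * ln \<rho> powr - m"

lemma eventually_ln_le_linear:
  fixes X Y a :: real
  assumes "a > 0"
  shows "eventually (\<lambda>l. X + Y * ln l \<le> a * l) at_top"
  using assms by real_asymp

lemma eventually_compose_ln:
  assumes "eventually P (at_top :: real filter)"
  shows "eventually (\<lambda>t. P (ln t)) at_top"
  using assms ln_at_top by (rule eventually_compose_filterlim)

text \<open>The exponents \<open>k\<close> and \<open>m\<close> are kept independent: upper bounds
  on the weight give up the factor \<open>ln \<rho> powr - m\<close>, and multiples of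
  \<open>ln (ln \<rho>)\<close> are absorbed by multiples of \<open>ln \<rho>\<close>. The
  assumption \<open>dominates\<close> covers the two ways in which
  \<open>\<kappa> * l powr (q - 1)\<close> can finally exceed \<open>\<theta>\<close>.\<close>

locale radial_profile =
  fixes g :: "real \<Rightarrow> real" and \<rho>\<^sub>0 c \<kappa> q k d \<theta> m :: real
  assumes ln_\<rho>\<^sub>0: "1 \<le> ln \<rho>\<^sub>0" and \<rho>\<^sub>0: "1 \<le> \<rho>\<^sub>0"
    and g_cont: "continuous_on UNIV g"
    and g_mono: "\<And>x y. \<rho>\<^sub>0 \<le> x \<Longrightarrow> x \<le> y \<Longrightarrow> g x \<le> g y"
    and g_lower: "\<And>\<rho>. \<rho>\<^sub>0 \<le> \<rho> \<Longrightarrow> c + \<kappa> * ln \<rho> powr q + d * ln \<rho> - k * ln (ln \<rho>) \<le> g \<rho>"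
    and \<kappa>_pos: "0 < \<kappa>" and q_ge: "1 \<le> q" and d_ge: "1 \<le> d"
    and \<theta>_pos': "0 < \<theta>" and \<theta>_less: "\<theta> < 2" and m_nonneg: "0 \<le> m"
    and dominates: "1 < q \<or> \<theta> < \<kappa>"
begin

abbreviation w where "w \<equiv> weight \<kappa> q \<theta> m"

text \<open>The margin \<open>\<delta>\<close> pays for logarithmic losses. It is
  \<open>\<kappa> - \<theta>\<close> for \<open>q = 1\<close>; for \<open>q > 1\<close> the margin 1
  is reached beyond the solution of \<open>\<kappa> * l powr (q - 1) = \<theta> + 1\<close>.\<close>

lemma slope:
  obtains \<delta> l\<^sub>0 where "\<delta> > 0" "l\<^sub>0 \<ge> 1" "\<And>l. l \<ge> l\<^sub>0 \<Longrightarrow> \<theta> + \<delta> \<le> \<kappa> * l powr (q - 1)"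
proof (cases "q = 1")
  case True
  then show ?thesis using dominates by (intro that[of "\<kappa> - \<theta>" 1]) auto
next
  case False
  then have "q > 1" using q_ge by simp
  define l\<^sub>0 where "l\<^sub>0 = max 1 (((\<theta> + 1) / \<kappa>) powr (1 / (q - 1)))"
  show ?thesis
  proof (rule that[of 1 l\<^sub>0])
    fix l assume "l \<ge> l\<^sub>0"
    then have "(((\<theta> + 1) / \<kappa>) powr (1 / (q - 1))) powr (q - 1) \<le> l powr (q - 1)"
      using \<open>q > 1\<close> by (intro powr_mono2) (auto simp: l\<^sub>0_def)
    then show "\<theta> + 1 \<le> \<kappa> * l powr (q - 1)"
      using \<open>q > 1\<close> \<kappa>_pos \<theta>_pos' by (simp add: powr_powr field_simps)
  qed (auto simp: l\<^sub>0_def)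
qed

lemma weight_le: "w \<rho> \<le> exp (\<kappa> * ln \<rho> powr q - \<theta> * ln \<rho>)" if "1 \<le> ln \<rho>"
proof -
  have "ln \<rho> powr - m \<le> ln \<rho> powr 0" using that m_nonneg by (intro powr_mono) auto
  then have "ln \<rho> powr - m \<le> 1" using that by simp
  then show ?thesis unfolding weight_def by (intro mult_left_le) auto
qed

lemma weight_pos: "0 < w \<rho>" if "1 \<le> ln \<rho>"
  using that by (simp add: weight_def)

text \<open>Source of the ordinary Poincare inequality: the kernel comparison for all pairs at once.
  Far out the margin from \<open>slope\<close> absorbs the term \<open>k * ln (ln \<rho>)\<close>;
  on the remaining compact interval \<open>g\<close> attains its minimum.\<close>

lemma exp_ge_powr:
  obtains K where "K > 0" "\<And>\<rho>. 0 \<le> \<rho> \<Longrightarrow> \<rho> powr (d + \<theta>) \<le> K * exp (g \<rho>)"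
proof -
  obtain \<delta> l\<^sub>0 where \<delta>: "\<delta> > 0" "l\<^sub>0 \<ge> 1" "\<And>l. l \<ge> l\<^sub>0 \<Longrightarrow> \<theta> + \<delta> \<le> \<kappa> * l powr (q - 1)"
    by (rule slope) blast
  have "eventually (\<lambda>l. - c + k * ln l \<le> \<delta> * l \<and> l\<^sub>0 \<le> l) at_top"
    using \<open>\<delta> > 0\<close> by (intro eventually_conj eventually_ln_le_linear eventually_ge_at_top)
  from eventually_conj[OF eventually_compose_ln[OF this] eventually_ge_at_top[of \<rho>\<^sub>0]]
  obtain \<rho>\<^sub>1 where \<rho>\<^sub>1: "\<And>\<rho>. \<rho> \<ge> \<rho>\<^sub>1 \<Longrightarrow> - c + k * ln (ln \<rho>) \<le> \<delta> * ln \<rho> \<and> l\<^sub>0 \<le> ln \<rho> \<and> \<rho>\<^sub>0 \<le> \<rho>"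
    unfolding eventually_at_top_linorder by blast
  have large: "\<rho> powr (d + \<theta>) \<le> exp (g \<rho>)" if "\<rho> \<ge> \<rho>\<^sub>1" for \<rho>
  proof -
    let ?l = "ln \<rho>"
    have l: "?l \<ge> l\<^sub>0" "\<rho> \<ge> \<rho>\<^sub>0" "- c + k * ln ?l \<le> \<delta> * ?l" using \<rho>\<^sub>1[OF that] by auto
    have "?l powr q = ?l powr (q - 1) * ?l"
      using l \<open>l\<^sub>0 \<ge> 1\<close> powr_add[of ?l "q - 1" 1] by simp
    moreover have "(\<theta> + \<delta>) * ?l \<le> \<kappa> * ?l powr (q - 1) * ?l"
      using \<delta>(3)[OF l(1)] l \<open>l\<^sub>0 \<ge> 1\<close> by (intro mult_right_mono) auto
    ultimately have "(d + \<theta>) * ?l \<le> g \<rho>"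
      using g_lower[OF l(2)] l(3) by (simp add: algebra_simps)
    then show ?thesis using l \<rho>\<^sub>0 by (simp add: powr_def)
  qed
  obtain x where x: "\<And>y. y \<in> {0..max 0 \<rho>\<^sub>1} \<Longrightarrow> g x \<le> g y"
    using continuous_attains_inf[OF compact_Icc _ continuous_on_subset[OF g_cont subset_UNIV], of 0 "max 0 \<rho>\<^sub>1"]
    by (metis atLeastatMost_empty_iff max.cobounded1)
  define K where "K = max 1 (max 0 \<rho>\<^sub>1 powr (d + \<theta>) / exp (g x))"
  show ?thesis
  proof (rule that[of K])
    fix \<rho> :: real assume "0 \<le> \<rho>"
    show "\<rho> powr (d + \<theta>) \<le> K * exp (g \<rho>)"
    proof (cases "\<rho> \<ge> \<rho>\<^sub>1")
      case True
      have "1 * exp (g \<rho>) \<le> K * exp (g \<rho>)" by (intro mult_right_mono) (auto simp: K_def)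
      then show ?thesis using large[OF True] by linarith
    next
      case False
      then have "\<rho> powr (d + \<theta>) \<le> max 0 \<rho>\<^sub>1 powr (d + \<theta>) / exp (g x) * exp (g x)"
        using \<open>0 \<le> \<rho>\<close> d_ge \<theta>_pos' by (auto intro!: powr_mono2)
      also have "\<dots> \<le> K * exp (g \<rho>)"
        using x[of \<rho>] False \<open>0 \<le> \<rho>\<close> by (intro mult_mono) (auto simp: K_def)
      finally show ?thesis .
    qed
  qed (simp add: K_def)
qed

text \<open>The gap between \<open>t\<close> and \<open>t powr (5/4)\<close> compensates for the logarithmic factors lost in
  the lower bound on \<open>g\<close>.\<close>

lemma eventually_weight_times_powr_le:
  assumes "K > 0"
  shows "eventually (\<lambda>t. \<forall>\<rho>\<ge>t powr (5/4). K * w t * \<rho> powr (d + \<theta>) \<le> exp (g \<rho>)) at_top"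
proof -
  obtain \<delta> l\<^sub>0 where \<delta>: "\<delta> > 0" "l\<^sub>0 \<ge> 1" "\<And>l. l \<ge> l\<^sub>0 \<Longrightarrow> \<theta> + \<delta> \<le> \<kappa> * l powr (q - 1)"
    by (rule slope) blast
  \<comment> \<open>The share 1/5 is what the gap provides: \<open>5/4 * l \<le> l'\<close> means
    \<open>l' - l \<ge> l' / 5\<close>, so the margin contributes at least
    \<open>\<delta> / 5 * l'\<close>.\<close>
  have "eventually (\<lambda>l. (ln K - c) + k * ln l \<le> \<delta> / 5 * l) at_top"
    using \<open>\<delta> > 0\<close> by (intro eventually_ln_le_linear) auto
  then obtain l\<^sub>1 where l\<^sub>1: "\<And>l. l \<ge> l\<^sub>1 \<Longrightarrow> (ln K - c) + k * ln l \<le> \<delta> / 5 * l"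
    unfolding eventually_at_top_linorder by blast
  have "eventually (\<lambda>t. l\<^sub>0 \<le> ln t \<and> l\<^sub>1 \<le> ln t \<and> \<rho>\<^sub>0 \<le> t) at_top"
    by (intro eventually_conj eventually_compose_ln eventually_ge_at_top)
  then show ?thesis
  proof eventually_elim
    case (elim t)
    show ?case
    proof (intro allI impI)
      fix \<rho> assume \<rho>: "t powr (5/4) \<le> \<rho>"
      have "t \<ge> 1" using elim \<rho>\<^sub>0 by simp
      then have "t powr 1 \<le> t powr (5/4)" by (intro powr_mono) auto
      then have "t \<le> \<rho>" using \<rho> \<open>t \<ge> 1\<close> by simp
      define l where "l = ln t"
      define l' where "l' = ln \<rho>"
      have "5/4 * l = ln (t powr (5/4))" using \<open>t \<ge> 1\<close> by (simp add: l_def ln_powr)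
      also have "\<dots> \<le> l'" unfolding l'_def using \<rho> \<open>t \<ge> 1\<close> by (intro ln_mono) auto
      finally have ll: "5/4 * l \<le> l'" .
      have "l \<ge> 1" "l \<ge> l\<^sub>0" "l \<ge> l\<^sub>1" using elim \<delta> by (auto simp: l_def)
      then have "l' \<ge> l" "l' \<ge> l\<^sub>1" using ll by auto
      have pw: "x powr q = x powr (q - 1) * x" if "x \<ge> 1" for x
        using that powr_add[of x "q - 1" 1] by simp
      \<comment> \<open>Instead of the mean value theorem:
        \<open>l' powr q - l powr q \<ge> l powr (q - 1) * (l' - l)\<close>, which reduces the
        growth from \<open>l\<close> to \<open>l'\<close> to the slope at \<open>l\<close>.\<close>
      have "l powr (q - 1) \<le> l' powr (q - 1)" using \<open>l' \<ge> l\<close> \<open>l \<ge> 1\<close> q_ge by (intro powr_mono2) auto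
      then have "l powr (q - 1) * l' \<le> l' powr q"
        using \<open>l' \<ge> l\<close> \<open>l \<ge> 1\<close> by (subst pw) (auto intro!: mult_right_mono)
      then have "\<kappa> * (l powr (q - 1) * l' - l powr q) \<le> \<kappa> * (l' powr q - l powr q)"
        using \<kappa>_pos by simp
      moreover have "\<kappa> * (l powr (q - 1) * l' - l powr q) = \<kappa> * l powr (q - 1) * (l' - l)"
        by (subst pw) (use \<open>l \<ge> 1\<close> in \<open>auto simp: algebra_simps\<close>)
      moreover have "(\<theta> + \<delta>) * (l' - l) \<le> \<kappa> * l powr (q - 1) * (l' - l)"
        using \<delta>(3)[OF \<open>l \<ge> l\<^sub>0\<close>] \<open>l' \<ge> l\<close> by (intro mult_right_mono) auto
      ultimately have "(\<theta> + \<delta>) * (l' - l) \<le> \<kappa> * l' powr q - \<kappa> * l powr q"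
        unfolding right_diff_distrib[of \<kappa>, symmetric] by linarith
      moreover have "\<delta> / 5 * l' \<le> \<delta> * (l' - l)"
        using ll \<open>\<delta> > 0\<close> mult_left_mono[of "l' / 5" "l' - l" \<delta>] by simp
      moreover have "(ln K - c) + k * ln l' \<le> \<delta> / 5 * l'" by (rule l\<^sub>1) fact
      moreover have "c + \<kappa> * l' powr q + d * l' - k * ln l' \<le> g \<rho>"
        unfolding l'_def using \<open>t \<le> \<rho>\<close> elim by (intro g_lower) auto
      ultimately have "ln K + (\<kappa> * l powr q - \<theta> * l) + (d + \<theta>) * l' \<le> g \<rho>"
        by (simp add: algebra_simps)
      then have "exp (ln K + (\<kappa> * l powr q - \<theta> * l) + (d + \<theta>) * l') \<le> exp (g \<rho>)" by simp
      moreover have "exp ((d + \<theta>) * l') = \<rho> powr (d + \<theta>)"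
        using \<open>t \<ge> 1\<close> \<open>t \<le> \<rho>\<close> by (simp add: powr_def l'_def)
      ultimately have "K * exp (\<kappa> * l powr q - \<theta> * l) * \<rho> powr (d + \<theta>) \<le> exp (g \<rho>)"
        using \<open>K > 0\<close> by (simp only: exp_add exp_ln)
      moreover have "K * w t * \<rho> powr (d + \<theta>) \<le> K * exp (\<kappa> * l powr q - \<theta> * l) * \<rho> powr (d + \<theta>)"
        using weight_le[of t] \<open>l \<ge> 1\<close> \<open>K > 0\<close> by (intro mult_right_mono mult_left_mono) (auto simp: l_def)
      ultimately show "K * w t * \<rho> powr (d + \<theta>) \<le> exp (g \<rho>)" by linarith
    qed
  qed
qed

text \<open>Equivalent to \<open>5/2 * (d + \<theta>) < (2 + d / \<theta>) * (d + \<theta>)\<close>,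
  that is \<open>d / \<theta> > 1 / 2\<close>, which follows from \<open>\<theta> < 2\<close> and
  \<open>d \<ge> 1\<close>. The factor 5/2 is twice the exponent 5/4.\<close>

lemma exponent_gap: "5/2 * (d + \<theta>) - (2 + d / \<theta>) * \<theta> < (2 + d / \<theta>) * d"
proof -
  define X where "X = d / \<theta> * d"
  have "d / \<theta> > 1 / 2" using d_ge \<theta>_pos' \<theta>_less by (simp add: field_simps)
  then have X: "X > 1 / 2 * 1" unfolding X_def using d_ge by (intro mult_less_le_imp_less) auto
  have 1: "(2 + d / \<theta>) * \<theta> = 2 * \<theta> + d" using \<theta>_pos' by (simp add: distrib_right)
  have 2: "(2 + d / \<theta>) * d = 2 * d + X" unfolding X_def by (rule distrib_right)
  show ?thesis unfolding 1 2 using X d_ge \<theta>_less by argo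
qed

text \<open>With \<open>P = 2 + d / \<theta>\<close>, the leading terms
  \<open>P * \<kappa> * l powr q\<close> of both sides cancel after taking logarithms. What is left
  is a comparison of powers of \<open>t\<close>, decided by \<open>exponent_gap\<close>, with room
  for constants and for \<open>ln l\<close>.\<close>

lemma eventually_weight_powr_le:
  assumes "K\<^sub>1 \<ge> 0" "K\<^sub>2 \<ge> 0"
  shows "eventually (\<lambda>t. K\<^sub>1 + K\<^sub>2 * (t powr (5/2 * (d + \<theta>)) * w t powr (2 + d / \<theta>))
    \<le> exp (g t) powr (2 + d / \<theta>)) at_top"
proof -
  define P where "P = 2 + d / \<theta>"
  have "P > 0" using d_ge \<theta>_pos' by (simp add: P_def add_pos_pos)
  define e where "e = 5/2 * (d + \<theta>) - P * \<theta>"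
  have "P * \<theta> = 2 * \<theta> + d" using \<theta>_pos' by (simp add: P_def distrib_right)
  then have "e > 0" using d_ge \<theta>_pos' by (simp add: e_def)
  have gap: "P * d - e > 0" using exponent_gap by (simp add: P_def e_def)
  have "eventually (\<lambda>l. (ln (K\<^sub>1 + K\<^sub>2 + 1) - P * c) + P * k * ln l \<le> (P * d - e) * l \<and> 1 \<le> l) at_top"
    using gap by (intro eventually_conj eventually_ln_le_linear eventually_ge_at_top)
  from eventually_conj[OF eventually_compose_ln[OF this] eventually_ge_at_top[of \<rho>\<^sub>0]]
  show ?thesis
  proof eventually_elim
    case (elim t)
    define l where "l = ln t"
    have "l \<ge> 1" "t \<ge> 1" "t \<ge> \<rho>\<^sub>0" using elim \<rho>\<^sub>0 by (auto simp: l_def)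
    let ?\<Phi> = "\<kappa> * l powr q"
    have "?\<Phi> \<ge> 0" using \<kappa>_pos by simp
    have "w t powr P \<le> exp (?\<Phi> - \<theta> * l) powr P"
      using weight_le[of t] weight_pos[of t] \<open>l \<ge> 1\<close> \<open>P > 0\<close> by (intro powr_mono2) (auto simp: l_def)
    also have "\<dots> = exp (P * (?\<Phi> - \<theta> * l))" by (simp add: powr_def)
    finally have "t powr (5/2 * (d + \<theta>)) * w t powr P \<le> exp (5/2 * (d + \<theta>) * l) * exp (P * (?\<Phi> - \<theta> * l))"
      using \<open>t \<ge> 1\<close> by (intro mult_mono) (auto simp: powr_def l_def)
    also have "\<dots> = exp (P * ?\<Phi>) * exp (e * l)"
      by (simp add: e_def exp_add[symmetric] algebra_simps)
    finally have "K\<^sub>2 * (t powr (5/2 * (d + \<theta>)) * w t powr P) \<le> K\<^sub>2 * (exp (P * ?\<Phi>) * exp (e * l))"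
      using \<open>K\<^sub>2 \<ge> 0\<close> by (rule mult_left_mono)
    moreover have "K\<^sub>1 * 1 \<le> K\<^sub>1 * (exp (P * ?\<Phi>) * exp (e * l))"
      unfolding exp_add[symmetric]
      using \<open>?\<Phi> \<ge> 0\<close> \<open>l \<ge> 1\<close> \<open>P > 0\<close> \<open>e > 0\<close> \<open>K\<^sub>1 \<ge> 0\<close> by (intro mult_left_mono) auto
    ultimately have "K\<^sub>1 + K\<^sub>2 * (t powr (5/2 * (d + \<theta>)) * w t powr P)
        \<le> (K\<^sub>1 + K\<^sub>2) * (exp (P * ?\<Phi>) * exp (e * l))"
      by (simp add: distrib_right)
    \<comment> \<open>The added 1 keeps the constant positive when both summands are zero, so that
      it can be written as the exponential of its logarithm.\<close>
    also have "\<dots> \<le> (K\<^sub>1 + K\<^sub>2 + 1) * (exp (P * ?\<Phi>) * exp (e * l))"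
      by (intro mult_right_mono) auto
    also have "\<dots> = exp (ln (K\<^sub>1 + K\<^sub>2 + 1) + e * l + P * ?\<Phi>)"
      using \<open>K\<^sub>1 \<ge> 0\<close> \<open>K\<^sub>2 \<ge> 0\<close> by (simp add: exp_add)
    also have "\<dots> \<le> exp (P * (c + ?\<Phi> + d * l - k * ln l))"
      using elim by (simp add: l_def algebra_simps)
    also have "\<dots> \<le> exp (P * g t)"
      using g_lower[OF \<open>t \<ge> \<rho>\<^sub>0\<close>] \<open>P > 0\<close> by (simp add: l_def)
    also have "\<dots> = exp (g t) powr P" by (simp add: powr_def)
    finally show ?case by (simp add: P_def)
  qed
qed

text \<open>Serves the local rate with second argument \<open>t\<close>, which must be at least 1
  for large \<open>t\<close>.\<close>

lemma eventually_le_exp_powr: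
  assumes "K > 0"
  shows "eventually (\<lambda>t. K \<le> exp (g t) powr (2 + d / \<theta>) * t powr (- (d / \<theta>))) at_top"
proof -
  define P where "P = 2 + d / \<theta>"
  have "P > 0" using d_ge \<theta>_pos' by (simp add: P_def add_pos_pos)
  have gap: "P * d - d / \<theta> > 0"
  proof -
    have "d / \<theta> * 1 \<le> d / \<theta> * d" using d_ge \<theta>_pos' by (intro mult_left_mono) auto
    then show ?thesis using d_ge by (simp only: P_def distrib_right)
  qed
  have "eventually (\<lambda>l. (ln K - P * c) + P * k * ln l \<le> (P * d - d / \<theta>) * l \<and> 1 \<le> l) at_top"
    using gap by (intro eventually_conj eventually_ln_le_linear eventually_ge_at_top)
  from eventually_conj[OF eventually_compose_ln[OF this] eventually_ge_at_top[of \<rho>\<^sub>0]]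
  show ?thesis
  proof eventually_elim
    case (elim t)
    define l where "l = ln t"
    have "l \<ge> 1" "t \<ge> 1" "t \<ge> \<rho>\<^sub>0" using elim \<rho>\<^sub>0 by (auto simp: l_def)
    have "0 \<le> P * (\<kappa> * l powr q)" using \<kappa>_pos \<open>P > 0\<close> by simp
    then have "ln K \<le> P * (c + \<kappa> * l powr q + d * l - k * ln l) - d / \<theta> * l"
      using elim by (simp add: l_def[symmetric] algebra_simps)
    also have "\<dots> \<le> P * g t - d / \<theta> * l"
      using g_lower[OF \<open>t \<ge> \<rho>\<^sub>0\<close>] \<open>P > 0\<close> by (simp add: l_def)
    finally have "exp (ln K) \<le> exp (P * g t - d / \<theta> * l)" by simp
    also have "\<dots> = exp (g t) powr P * t powr (- (d / \<theta>))"
      using \<open>t \<ge> 1\<close> by (simp add: powr_def l_def exp_diff exp_minus divide_inverse)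
    finally show ?case using \<open>K > 0\<close> by (simp add: P_def)
  qed
qed

text \<open>Unbounded growth lets the term with the infimum of \<open>\<omega>\<close> fall below
  any \<open>r\<close>, so the constraint in \<open>super_rate\<close> can be met.\<close>

lemma eventually_weight_ge: "eventually (\<lambda>t. K \<le> w t) at_top"
proof -
  obtain \<delta> l\<^sub>0 where \<delta>: "\<delta> > 0" "l\<^sub>0 \<ge> 1" "\<And>l. l \<ge> l\<^sub>0 \<Longrightarrow> \<theta> + \<delta> \<le> \<kappa> * l powr (q - 1)"
    by (rule slope) blast
  define K' where "K' = max K 1"
  have "eventually (\<lambda>l. ln K' + m * ln l \<le> \<delta> * l \<and> l\<^sub>0 \<le> l) at_top"
    using \<open>\<delta> > 0\<close> by (intro eventually_conj eventually_ln_le_linear eventually_ge_at_top)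
  from eventually_compose_ln[OF this] show ?thesis
  proof eventually_elim
    case (elim t)
    define l where "l = ln t"
    have l: "l \<ge> l\<^sub>0" "l \<ge> 1" "ln K' + m * ln l \<le> \<delta> * l" using elim \<delta> by (auto simp: l_def)
    have "l powr q = l powr (q - 1) * l" using l powr_add[of l "q - 1" 1] by simp
    moreover have "(\<theta> + \<delta>) * l \<le> \<kappa> * l powr (q - 1) * l"
      using \<delta>(3)[OF l(1)] l by (intro mult_right_mono) auto
    ultimately have "ln K' \<le> \<kappa> * l powr q - \<theta> * l + - m * ln l"
      using l(3) by (simp add: algebra_simps)
    then have "exp (ln K') \<le> exp (\<kappa> * l powr q - \<theta> * l + - m * ln l)" by simp
    also have "\<dots> = w t" using l by (simp only: exp_add) (simp add: weight_def powr_def l_def)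
    finally show ?case by (simp add: K'_def)
  qed
qed

text \<open>The terms with \<open>ln t powr q\<close> cancel and leave
  \<open>t powr (- (d + \<theta>))\<close> times a power of \<open>ln t\<close>. Half of
  \<open>\<theta>\<close> absorbs that power, and the other half keeps integrability at
  infinity.\<close>

lemma eventually_weight_exp_le:
  "eventually (\<lambda>t. w t * exp (- g t) \<le> t powr (- (d + \<theta> / 2))) at_top"
proof -
  have "eventually (\<lambda>l. - c + k * ln l \<le> \<theta> / 2 * l \<and> 1 \<le> l) at_top"
    using \<theta>_pos' by (intro eventually_conj eventually_ln_le_linear eventually_ge_at_top) auto
  from eventually_conj[OF eventually_compose_ln[OF this] eventually_ge_at_top[of \<rho>\<^sub>0]]
  show ?thesis
  proof eventually_elim
    case (elim t)
    define l where "l = ln t"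
    have "l \<ge> 1" "t \<ge> 1" "t \<ge> \<rho>\<^sub>0" using elim \<rho>\<^sub>0 by (auto simp: l_def)
    have "w t * exp (- g t) \<le> exp (\<kappa> * l powr q - \<theta> * l) * exp (- (c + \<kappa> * l powr q + d * l - k * ln l))"
      using weight_le[of t] g_lower[OF \<open>t \<ge> \<rho>\<^sub>0\<close>] \<open>l \<ge> 1\<close> by (intro mult_mono) (auto simp: l_def)
    also have "\<dots> = exp (- c + k * ln l - (d + \<theta>) * l)"
      by (simp add: exp_add[symmetric] algebra_simps)
    also have "\<dots> \<le> exp (- (d + \<theta> / 2) * l)"
      using elim by (simp add: l_def algebra_simps)
    also have "\<dots> = t powr (- (d + \<theta> / 2))"
      using \<open>t \<ge> 1\<close> by (simp add: powr_def l_def)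
    finally show ?case .
  qed
qed

end

section \<open>The super Poincare inequality for radial potentials\<close>

text \<open>On the shell \<open>2 ^ n \<le> norm x \<le> 2 ^ Suc n\<close> the integrand is at most
  its value at radius \<open>2 ^ n\<close>, and the shell lies in a ball of volume proportional to
  \<open>2 ^ (n * DIM('a))\<close>. This leaves a geometric series of ratio
  \<open>2 powr - \<eta>\<close>.\<close>

lemma nn_integral_norm_powr_tail:
  assumes "\<eta> > 0"
  shows "(\<integral>\<^sup>+x. ennreal (norm (x::'a::euclidean_space) powr - (real DIM('a) + \<eta>)) * indicator {x. 1 \<le> norm x} x \<partial>lborel) < \<infinity>"
proof -
  let ?s = "real DIM('a) + \<eta>"
  have le_suminf: "f n \<le> (\<Sum>n. f n)" for f :: "nat \<Rightarrow> ennreal" and n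
    using sum_le_suminf[of f "{n}"] by simp
  let ?h = "\<lambda>n x::'a. ennreal ((2 ^ n) powr - ?s) * indicator (cball 0 (2 ^ Suc n)) x"
  have "(\<integral>\<^sup>+x. ennreal (norm (x::'a) powr - ?s) * indicator {x. 1 \<le> norm x} x \<partial>lborel)
      \<le> (\<integral>\<^sup>+x. (\<Sum>n. ?h n x) \<partial>lborel)"
  proof (intro nn_integral_mono)
    fix x :: 'a
    show "ennreal (norm x powr - ?s) * indicator {x. 1 \<le> norm x} x \<le> (\<Sum>n. ?h n x)"
    proof (cases "1 \<le> norm x")
      case True
      have "\<exists>n. norm x \<le> 2 ^ Suc n"
        using real_arch_pow[of 2 "norm x"] by (metis less_imp_le power_Suc less_le_trans lessI one_less_numeral_iff semiring_norm(76) power_strict_increasing_iff)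
      define n where "n = (LEAST n. norm x \<le> 2 ^ Suc n)"
      have le: "norm x \<le> 2 ^ Suc n" unfolding n_def by (rule LeastI_ex) fact
      have ge: "2 ^ n \<le> norm x"
      proof (cases n)
        case (Suc j)
        have "\<not> norm x \<le> 2 ^ Suc j"
          using not_less_Least[of j "\<lambda>n. norm x \<le> 2 ^ Suc n"] Suc n_def by simp
        then show ?thesis using Suc by simp
      qed (use True in simp)
      have "ennreal (norm x powr - ?s) \<le> ?h n x"
        using le ge \<open>\<eta> > 0\<close> by (auto intro!: ennreal_leI powr_mono2')
      also have "\<dots> \<le> (\<Sum>n. ?h n x)" by (rule le_suminf)
      finally show ?thesis using True by simp
    qed simp
  qed
  also have "\<dots> = (\<Sum>n. \<integral>\<^sup>+x. ?h n x \<partial>lborel)"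
    by (rule nn_integral_suminf)
      (intro borel_measurable_times_ennreal borel_measurable_const borel_measurable_indicator, simp)
  also have "\<dots> = (\<Sum>n. ennreal (unit_ball_vol (real DIM('a)) * 2 ^ DIM('a) * (2 powr - \<eta>) ^ n))"
  proof (intro suminf_cong)
    fix n
    have "(\<integral>\<^sup>+x. ?h n x \<partial>lborel) = ennreal ((2 ^ n) powr - ?s) * ennreal (unit_ball_vol (real DIM('a)) * (2 ^ Suc n) ^ DIM('a))"
      by (subst nn_integral_cmult_indicator, simp, subst emeasure_cball, simp_all)
    also have "\<dots> = ennreal ((2 ^ n) powr - ?s * (unit_ball_vol (real DIM('a)) * (2 ^ Suc n) ^ DIM('a)))"
      by (rule ennreal_mult[symmetric]) auto
    also have "(2 ^ n) powr - ?s * (unit_ball_vol (real DIM('a)) * (2 ^ Suc n) ^ DIM('a))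
       = unit_ball_vol (real DIM('a)) * 2 ^ DIM('a) * (2 powr - \<eta>) ^ n"
    proof -
      have "(2 ^ n) powr - ?s = (2 powr real n) powr - ?s" by (simp add: powr_realpow)
      also have "\<dots> = 2 powr (- (real n * real DIM('a))) * 2 powr (- \<eta> * real n)"
        by (simp add: powr_powr powr_add[symmetric] algebra_simps)
      also have "2 powr (- \<eta> * real n) = (2 powr - \<eta>) ^ n"
        by (simp add: powr_powr flip: powr_realpow)
      finally have "(2 ^ n) powr - ?s = 2 powr (- (real n * real DIM('a))) * (2 powr - \<eta>) ^ n" .
      moreover have "(2 ^ Suc n) ^ DIM('a) = 2 ^ DIM('a) * 2 powr (real n * real DIM('a))"
      proof -
        have "2 powr (real n * real DIM('a)) = 2 ^ (n * DIM('a))"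
          using powr_realpow[of 2 "n * DIM('a)"] by simp
        then show ?thesis by (simp add: power_mult power_mult_distrib)
      qed
      ultimately show ?thesis by (simp add: powr_minus field_simps)
    qed
    finally show "(\<integral>\<^sup>+x. ?h n x \<partial>lborel) = ennreal (unit_ball_vol (real DIM('a)) * 2 ^ DIM('a) * (2 powr - \<eta>) ^ n)" .
  qed
  also have "\<dots> < \<infinity>"
  proof -
    have "2 powr - \<eta> < 1" using \<open>\<eta> > 0\<close> by (simp add: powr_less_one)
    then have "summable (\<lambda>n. unit_ball_vol (real DIM('a)) * 2 ^ DIM('a) * (2 powr - \<eta>) ^ n)"
      by (intro summable_mult summable_geometric) auto
    then show ?thesis by (subst suminf_ennreal2) auto
  qed
  finally show ?thesis .
qed

context gibbs_potential
begin

text \<open>The objective decreases in \<open>u\<close>, and the constraint reads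
  \<open>u \<le> (\<sigma> * i / a) powr (1 / \<theta>)\<close>. The stated bound is the objective
  at this largest \<open>u\<close>, which is also the witness for finiteness.\<close>

lemma local_rate_bounds:
  assumes a: "(SUP z\<in>{z. norm z \<le> 2 * t}. ennreal (exp (V z))) = ennreal a" "a > 0"
    and i: "(INF z\<in>{z. norm z \<le> t}. ennreal (exp (V z))) = ennreal i" "i > 0"
    and "\<sigma> > 0"
  shows "ennreal (a powr (2 + real DIM('a) / \<theta>) * i powr - (1 + real DIM('a) / \<theta>) * \<sigma> powr - (real DIM('a) / \<theta>))
    \<le> local_rate \<theta> V t \<sigma>"
    and "local_rate \<theta> V t \<sigma> < \<infinity>"
proof -
  define S where "S = {u. u > 0 \<and> ennreal (u powr \<theta>) * ennreal a / ennreal i \<le> ennreal \<sigma>}"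
  have S: "u \<in> S \<longleftrightarrow> u > 0 \<and> u powr \<theta> * a / i \<le> \<sigma>" for u
    using a i \<open>\<sigma> > 0\<close> unfolding S_def
    by (auto simp: ennreal_mult[symmetric] divide_ennreal)
  have val: "(ennreal a)\<^sup>2 / (ennreal (u ^ DIM('a)) * ennreal i) = ennreal (a\<^sup>2 / (u ^ DIM('a) * i))" if "u \<in> S" for u
    using that a i unfolding S by (simp add: ennreal_power ennreal_mult[symmetric] divide_ennreal)
  have rate: "local_rate \<theta> V t \<sigma> = (INF u\<in>S. ennreal (a\<^sup>2 / (u ^ DIM('a) * i)))"
    unfolding local_rate_def Let_def a(1) i(1) S_def[symmetric]
    by (intro INF_cong refl val)
  let ?b = "(\<sigma> * i / a) powr (real DIM('a) / \<theta>)"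
  show "ennreal (a powr (2 + real DIM('a) / \<theta>) * i powr - (1 + real DIM('a) / \<theta>) * \<sigma> powr - (real DIM('a) / \<theta>))
    \<le> local_rate \<theta> V t \<sigma>"
    unfolding rate
  proof (intro INF_greatest ennreal_leI)
    fix u assume "u \<in> S"
    then have "u > 0" and u: "u powr \<theta> \<le> \<sigma> * i / a"
      using a i unfolding S by (auto simp: field_simps)
    have "u ^ DIM('a) = (u powr \<theta>) powr (real DIM('a) / \<theta>)"
      using \<open>u > 0\<close> \<theta>_pos by (simp add: powr_powr powr_realpow)
    also have "\<dots> \<le> ?b"
      using u \<theta>_pos by (intro powr_mono2) auto
    finally have "u ^ DIM('a) \<le> ?b" .
    then have "a\<^sup>2 / (?b * i) \<le> a\<^sup>2 / (u ^ DIM('a) * i)"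
      using \<open>u > 0\<close> a i \<open>\<sigma> > 0\<close> by (intro divide_left_mono mult_right_mono mult_pos_pos) auto
    moreover have "a powr (2 + real DIM('a) / \<theta>) * i powr - (1 + real DIM('a) / \<theta>) * \<sigma> powr - (real DIM('a) / \<theta>) = a\<^sup>2 / (?b * i)"
    proof -
      let ?\<delta> = "real DIM('a) / \<theta>"
      have "a powr (2 + ?\<delta>) = a\<^sup>2 * a powr ?\<delta>"
        using a powr_realpow[of a 2] by (simp add: powr_add)
      moreover have "i powr - (1 + ?\<delta>) = 1 / (i * i powr ?\<delta>)"
        using i by (simp only: powr_minus_divide powr_add) simp
      moreover have "\<sigma> powr - ?\<delta> = 1 / \<sigma> powr ?\<delta>" by (rule powr_minus_divide)
      moreover have "?b = \<sigma> powr ?\<delta> * i powr ?\<delta> / a powr ?\<delta>"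
        using a i \<open>\<sigma> > 0\<close> by (simp add: powr_mult powr_divide)
      ultimately show ?thesis by simp
    qed
    ultimately show "a powr (2 + real DIM('a) / \<theta>) * i powr - (1 + real DIM('a) / \<theta>) * \<sigma> powr - (real DIM('a) / \<theta>)
      \<le> a\<^sup>2 / (u ^ DIM('a) * i)" by simp
  qed
  have "(\<sigma> * i / a) powr (1 / \<theta>) \<in> S"
    using a i \<open>\<sigma> > 0\<close> \<theta>_pos unfolding S by (simp add: powr_powr)
  then show "local_rate \<theta> V t \<sigma> < \<infinity>"
    unfolding rate by (intro le_less_trans[OF INF_lower]) auto
qed

end

locale radial_gibbs = gibbs_potential V \<theta> + radial_profile g \<rho>\<^sub>0 c \<kappa> q k "real DIM('a)" \<theta> m
  for V :: "'a::euclidean_space \<Rightarrow> real" and \<theta> g \<rho>\<^sub>0 c \<kappa> q k m +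
  assumes V_radial: "V x = g (norm x)"
begin

lemma V_cont: "continuous_on UNIV V"
proof -
  have "continuous_on UNIV (\<lambda>x::'a. g (norm x))"
    using continuous_on_compose2[OF g_cont continuous_on_norm_id] by auto
  then show ?thesis by (simp add: V_radial[abs_def])
qed

text \<open>Two crude facts suffice: a point of norm \<open>t\<close> lies in the ball of radius
  \<open>2 * t\<close>, so the supremum is at least \<open>exp (g t)\<close>, and the origin bounds
  the infimum by \<open>exp (g 0)\<close>. Compactness keeps the supremum finite and the infimum
  positive.\<close>

lemma local_rate_radial:
  assumes "t > 0" "\<sigma> > 0"
  shows "ennreal (exp (g t) powr (2 + real DIM('a) / \<theta>) * exp (g 0) powr - (1 + real DIM('a) / \<theta>) * \<sigma> powr - (real DIM('a) / \<theta>))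
      \<le> local_rate \<theta> V t \<sigma>"
    and "local_rate \<theta> V t \<sigma> < \<infinity>"
proof -
  have cb: "{z::'a. norm z \<le> r} = cball 0 r" for r by (auto simp: dist_norm)
  have V_cont': "continuous_on S V" for S
    using V_cont by (rule continuous_on_subset) auto
  obtain x where x: "\<And>z. norm z \<le> 2 * t \<Longrightarrow> V z \<le> V x"
    using continuous_attains_sup[OF compact_cball _ V_cont', of 0 "2 * t"] \<open>t > 0\<close> by (force simp: cb[symmetric])
  obtain y where y: "\<And>z. norm z \<le> t \<Longrightarrow> V y \<le> V z"
    using continuous_attains_inf[OF compact_cball _ V_cont', of 0 t] \<open>t > 0\<close> by (force simp: cb[symmetric])
  define A where "A = (SUP z\<in>{z. norm z \<le> 2 * t}. ennreal (exp (V z)))"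
  define I where "I = (INF z\<in>{z. norm z \<le> t}. ennreal (exp (V z)))"
  have "A \<le> ennreal (exp (V x))" unfolding A_def by (intro SUP_least ennreal_leI) (auto intro: x)
  then obtain a where a: "A = ennreal a" "a \<ge> 0"
    by (cases A) (auto simp: top_unique)
  obtain e :: 'a where e: "norm e = t" using \<open>t > 0\<close> vector_choose_size[of t] by auto
  have "ennreal (exp (g t)) \<le> A"
    unfolding A_def using e \<open>t > 0\<close> V_radial[of e] by (intro SUP_upper2[of e]) auto
  then have at: "exp (g t) \<le> a" unfolding a(1) using a(2) by (subst (asm) ennreal_le_iff) auto
  then have "a > 0" using less_le_trans[OF exp_gt_zero] by blast
  have "I \<le> ennreal (exp (g 0))"
    unfolding I_def using \<open>t > 0\<close> V_radial[of 0] by (intro INF_lower2[of 0]) auto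
  moreover have "ennreal (exp (V y)) \<le> I" unfolding I_def by (intro INF_greatest ennreal_leI) (auto intro: y)
  ultimately obtain i where i: "I = ennreal i" "exp (V y) \<le> i" "i \<le> exp (g 0)"
    by (cases I) (auto simp: top_unique)
  then have "i > 0" using less_le_trans[OF exp_gt_zero] by blast
  note bounds = local_rate_bounds[OF a(1)[unfolded A_def] \<open>a > 0\<close> i(1)[unfolded I_def] \<open>i > 0\<close> \<open>\<sigma> > 0\<close>]
  have "exp (g t) powr (2 + real DIM('a) / \<theta>) \<le> a powr (2 + real DIM('a) / \<theta>)"
    using at \<theta>_pos by (intro powr_mono2) auto
  moreover have "exp (g 0) powr - (1 + real DIM('a) / \<theta>) \<le> i powr - (1 + real DIM('a) / \<theta>)"
    using i(3) \<open>i > 0\<close> \<theta>_pos by (intro powr_mono2') (auto intro: order_trans[of _ 0])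
  ultimately show "ennreal (exp (g t) powr (2 + real DIM('a) / \<theta>) * exp (g 0) powr - (1 + real DIM('a) / \<theta>) * \<sigma> powr - (real DIM('a) / \<theta>))
      \<le> local_rate \<theta> V t \<sigma>"
    by (intro order_trans[OF _ bounds(1)] ennreal_leI mult_right_mono mult_mono) auto
  show "local_rate \<theta> V t \<sigma> < \<infinity>" by (rule bounds(2))
qed

section \<open>The threshold radius and the integrability of the weight\<close>

text \<open>For the larger norm \<open>\<rho>\<close> one has
  \<open>norm (x - y) \<le> 2 * \<rho>\<close>, while \<open>exp (g \<rho>)\<close> is one of the
  two summands. Growth of \<open>g\<close> beyond \<open>norm x\<close> therefore handles every
  \<open>y\<close>.\<close>

lemma norm_diff_powr_le:
  fixes x y :: 'a
  assumes K: "\<And>\<rho>. \<rho> \<ge> norm x \<Longrightarrow> K * \<rho> powr (real DIM('a) + \<theta>) \<le> exp (g \<rho>)" and "K > 0"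
  shows "norm (x - y) powr (real DIM('a) + \<theta>) \<le> 2 powr (real DIM('a) + \<theta>) / K * (exp (V x) + exp (V y))"
proof -
  define \<rho> where "\<rho> = max (norm x) (norm y)"
  have "norm (x - y) \<le> 2 * \<rho>"
    using norm_triangle_ineq4[of x y] by (simp add: \<rho>_def)
  then have "norm (x - y) powr (real DIM('a) + \<theta>) \<le> (2 * \<rho>) powr (real DIM('a) + \<theta>)"
    using \<theta>_pos by (intro powr_mono2) auto
  also have "\<dots> = 2 powr (real DIM('a) + \<theta>) / K * (K * \<rho> powr (real DIM('a) + \<theta>))"
    using \<open>K > 0\<close> by (simp add: powr_mult \<rho>_def)
  also have "\<dots> \<le> 2 powr (real DIM('a) + \<theta>) / K * exp (g \<rho>)"
    using \<open>K > 0\<close> by (intro mult_left_mono K) (auto simp: \<rho>_def)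
  also have "\<dots> \<le> 2 powr (real DIM('a) + \<theta>) / K * (exp (V x) + exp (V y))"
    using \<open>K > 0\<close> by (intro mult_left_mono) (auto simp: \<rho>_def V_radial max_def)
  finally show ?thesis .
qed

text \<open>Either \<open>t = T\<close> works, or the intermediate value theorem gives
  \<open>t \<le> T\<close> with \<open>exp (g t) = K * T powr p\<close>, \<open>p\<close> being the
  exponent of the kernel. In the second case monotonicity keeps \<open>exp (g \<rho>)\<close> above
  this value on the interval from \<open>t\<close> to \<open>T\<close>, where
  \<open>K * \<rho> powr p\<close> does not exceed it.\<close>

lemma threshold_radius:
  assumes \<rho>\<^sub>1: "\<rho>\<^sub>0 \<le> \<rho>\<^sub>1" and "T \<ge> \<rho>\<^sub>1" "K > 0"
    and far: "\<And>\<rho>. \<rho> \<ge> T \<Longrightarrow> K * \<rho> powr (real DIM('a) + \<theta>) \<le> exp (g \<rho>)"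
    and near: "\<And>\<rho>. 0 \<le> \<rho> \<Longrightarrow> \<rho> \<le> \<rho>\<^sub>1 \<Longrightarrow> exp (g \<rho>) \<le> K * T powr (real DIM('a) + \<theta>)"
  obtains t where "\<rho>\<^sub>1 \<le> t"
    "\<And>\<rho>. 0 \<le> \<rho> \<Longrightarrow> \<rho> \<le> t \<Longrightarrow> exp (g \<rho>) \<le> K * T powr (real DIM('a) + \<theta>)"
    "\<And>\<rho>. \<rho> \<ge> t \<Longrightarrow> K * \<rho> powr (real DIM('a) + \<theta>) \<le> exp (g \<rho>)"
proof (cases "exp (g T) \<le> K * T powr (real DIM('a) + \<theta>)")
  case True
  have "exp (g \<rho>) \<le> K * T powr (real DIM('a) + \<theta>)" if "0 \<le> \<rho>" "\<rho> \<le> T" for \<rho>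
  proof (cases "\<rho> \<le> \<rho>\<^sub>1")
    case False
    then have "exp (g \<rho>) \<le> exp (g T)" using that g_mono \<rho>\<^sub>1 by simp
    then show ?thesis using True by linarith
  qed (use near that in auto)
  then show ?thesis using that[of T] \<open>T \<ge> \<rho>\<^sub>1\<close> far by blast
next
  case False
  let ?L = "K * T powr (real DIM('a) + \<theta>)"
  have "continuous_on {\<rho>\<^sub>1..T} (\<lambda>\<rho>. exp (g \<rho>))"
    using g_cont by (intro continuous_on_exp) (rule continuous_on_subset, auto)
  moreover have "exp (g \<rho>\<^sub>1) \<le> ?L" using near[of \<rho>\<^sub>1] \<rho>\<^sub>0 \<rho>\<^sub>1 by simp
  ultimately obtain t where t: "\<rho>\<^sub>1 \<le> t" "t \<le> T" "exp (g t) = ?L"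
    using IVT'[of "\<lambda>\<rho>. exp (g \<rho>)" \<rho>\<^sub>1 ?L T] False \<open>T \<ge> \<rho>\<^sub>1\<close> by auto
  show ?thesis
  proof (rule that[OF t(1)])
    fix \<rho> :: real assume "0 \<le> \<rho>" "\<rho> \<le> t"
    show "exp (g \<rho>) \<le> ?L"
    proof (cases "\<rho> \<le> \<rho>\<^sub>1")
      case False
      then have "exp (g \<rho>) \<le> exp (g t)" using \<open>\<rho> \<le> t\<close> g_mono \<rho>\<^sub>1 by simp
      then show ?thesis unfolding t(3) .
    qed (use near \<open>0 \<le> \<rho>\<close> in auto)
  next
    fix \<rho> assume "t \<le> \<rho>"
    show "K * \<rho> powr (real DIM('a) + \<theta>) \<le> exp (g \<rho>)"
    proof (cases "T \<le> \<rho>")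
      case False
      then have "K * \<rho> powr (real DIM('a) + \<theta>) \<le> ?L"
        using \<open>K > 0\<close> \<open>t \<le> \<rho>\<close> t \<rho>\<^sub>0 \<rho>\<^sub>1 \<theta>_pos by (intro mult_left_mono powr_mono2) auto
      also have "?L = exp (g t)" using t(3) by (rule sym)
      also have "\<dots> \<le> exp (g \<rho>)" using t(1) \<rho>\<^sub>1 \<open>t \<le> \<rho>\<close> g_mono[of t \<rho>] by simp
      finally show ?thesis .
    qed (rule far)
  qed
qed

lemma nn_integral_weight:
  assumes "C \<ge> 0" "1 \<le> ln R" "1 \<le> R"
  shows "(\<integral>\<^sup>+x. ennreal (C * w (max R (norm x))) \<partial>\<mu>) < \<infinity>"
proof -
  obtain \<rho>\<^sub>2 where \<rho>\<^sub>2: "\<And>t. t \<ge> \<rho>\<^sub>2 \<Longrightarrow> w t * exp (- g t) \<le> t powr (- (real DIM('a) + \<theta> / 2))"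
    using eventually_weight_exp_le unfolding eventually_at_top_linorder by blast
  define \<rho>\<^sub>3 where "\<rho>\<^sub>3 = max \<rho>\<^sub>2 R"
  have [measurable]: "(\<lambda>x::'a. w (max R (norm x))) \<in> borel_measurable borel"
    unfolding weight_def by measurable
  define K where "K = exp (\<kappa> * ln \<rho>\<^sub>3 powr q)"
  let ?tail = "\<lambda>x::'a. ennreal (norm x powr - (real DIM('a) + \<theta> / 2)) * indicator {x. 1 \<le> norm x} x"
  have "(\<integral>\<^sup>+x. ennreal (C * w (max R (norm x))) \<partial>\<mu>)
     = (\<integral>\<^sup>+x. ennreal (exp (- V x)) * ennreal (C * w (max R (norm x))) \<partial>lborel)"
    by (intro nn_integral_density) measurable
  also have "\<dots> \<le> (\<integral>\<^sup>+x. ennreal C * ?tail x + ennreal (C * K) * ennreal (exp (- V x)) \<partial>lborel)"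
  proof (intro nn_integral_mono)
    fix x :: 'a
    show "ennreal (exp (- V x)) * ennreal (C * w (max R (norm x)))
       \<le> ennreal C * ?tail x + ennreal (C * K) * ennreal (exp (- V x))"
    proof (cases "\<rho>\<^sub>3 \<le> norm x")
      case True
      then have "norm x \<ge> R" "norm x \<ge> \<rho>\<^sub>2" by (auto simp: \<rho>\<^sub>3_def)
      then have "C * (w (norm x) * exp (- V x)) \<le> C * norm x powr - (real DIM('a) + \<theta> / 2)"
        using \<rho>\<^sub>2[of "norm x"] \<open>C \<ge> 0\<close> by (intro mult_left_mono) (auto simp: V_radial)
      then have "ennreal (exp (- V x) * (C * w (norm x))) \<le> ennreal (C * norm x powr - (real DIM('a) + \<theta> / 2))"
        by (intro ennreal_leI) (simp add: ac_simps)
      moreover have "ennreal (exp (- V x)) * ennreal (C * w (max R (norm x))) = ennreal (exp (- V x) * (C * w (norm x)))"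
        using \<open>norm x \<ge> R\<close> by (simp add: ennreal_mult')
      ultimately have "ennreal (exp (- V x)) * ennreal (C * w (max R (norm x))) \<le> ennreal C * ?tail x"
        using \<open>norm x \<ge> R\<close> \<open>1 \<le> R\<close> \<open>C \<ge> 0\<close> by (simp add: ennreal_mult')
      then show ?thesis by (rule order_trans) simp
    next
      case False
      define \<rho> where "\<rho> = max R (norm x)"
      have \<rho>: "R \<le> \<rho>" "\<rho> \<le> \<rho>\<^sub>3" using False by (auto simp: \<rho>_def \<rho>\<^sub>3_def)
      have "ln R \<le> ln \<rho>" "ln \<rho> \<le> ln \<rho>\<^sub>3" using \<rho> \<open>1 \<le> R\<close> by (auto intro!: ln_mono)
      then have l: "1 \<le> ln \<rho>" "ln \<rho> \<le> ln \<rho>\<^sub>3" using \<open>1 \<le> ln R\<close> by auto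
      have "w \<rho> \<le> exp (\<kappa> * ln \<rho> powr q - \<theta> * ln \<rho>)" by (rule weight_le) fact
      also have "\<kappa> * ln \<rho> powr q - \<theta> * ln \<rho> \<le> \<kappa> * ln \<rho>\<^sub>3 powr q - 0"
        using l \<kappa>_pos \<theta>_pos q_ge by (intro diff_mono mult_left_mono powr_mono2) auto
      finally have "w \<rho> \<le> K" by (simp add: K_def)
      then have "exp (- V x) * (C * w \<rho>) \<le> C * K * exp (- V x)"
        using \<open>C \<ge> 0\<close> by (simp add: mult_left_mono)
      then have "ennreal (exp (- V x) * (C * w \<rho>)) \<le> ennreal (C * K * exp (- V x))" by (rule ennreal_leI)
      moreover have "ennreal (exp (- V x) * (C * w \<rho>)) = ennreal (exp (- V x)) * ennreal (C * w \<rho>)"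
        by (rule ennreal_mult') simp
      moreover have "ennreal (C * K * exp (- V x)) = ennreal (C * K) * ennreal (exp (- V x))"
        by (rule ennreal_mult'') simp
      ultimately have "ennreal (exp (- V x)) * ennreal (C * w \<rho>) \<le> ennreal (C * K) * ennreal (exp (- V x))" by simp
      then show ?thesis unfolding \<rho>_def by (rule order_trans) simp
    qed
  qed
  also have "\<dots> = ennreal C * (\<integral>\<^sup>+x. ?tail x \<partial>lborel) + ennreal (C * K)"
    by (simp add: nn_integral_add nn_integral_cmult mass)
  also have "\<dots> < \<infinity>"
    using nn_integral_norm_powr_tail[where 'a = 'a and \<eta> = "\<theta> / 2"] \<theta>_pos by (simp add: ennreal_mult_less_top)
  finally show ?thesis .
qed

lemma gibbs_eq: "gibbs V = \<mu>"
proof -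
  have "norm_const V = 1"
    unfolding norm_const_def by (subst integral_eq_nn_integral) (auto simp: mass)
  then show ?thesis by (simp add: gibbs_def)
qed

text \<open>The constants give each region one half of \<open>r\<close>: outside,
  \<open>4 * (2 powr p / K) = r / 2\<close>; inside, \<open>u powr \<theta> = \<beta> * r\<close>
  gives \<open>2 * u powr p / v = r / 2\<close>. Here \<open>p = d + \<theta>\<close>, and
  \<open>\<beta>\<close> is a geometric constant, not the exponent in \<open>\<psi>\<close>. The
  bound on \<open>(\<beta> * r) powr (1 / \<theta>)\<close> keeps \<open>u\<close> below the
  threshold radius.\<close>

lemma super_poincare_estimate_radial:
  fixes \<phi> :: "'a \<Rightarrow> real" and T r :: real
  defines "K \<equiv> 2 powr (real DIM('a) + \<theta> + 3) / r"
    and "\<beta> \<equiv> unit_ball_vol (real DIM('a)) / 2 ^ (DIM('a) + 2)"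
  assumes \<phi>: "\<phi> \<in> borel_measurable borel" "integrable \<mu> (\<lambda>x. (\<phi> x)\<^sup>2)" and "r > 0"
    and \<rho>\<^sub>1: "\<rho>\<^sub>0 \<le> \<rho>\<^sub>1" "\<rho>\<^sub>1 \<le> T" "(\<beta> * r) powr (1 / \<theta>) \<le> \<rho>\<^sub>1"
    and far: "\<And>\<rho>. \<rho> \<ge> T \<Longrightarrow> K * \<rho> powr (real DIM('a) + \<theta>) \<le> exp (g \<rho>)"
    and near: "\<And>\<rho>. 0 \<le> \<rho> \<Longrightarrow> \<rho> \<le> \<rho>\<^sub>1 \<Longrightarrow> exp (g \<rho>) \<le> K * T powr (real DIM('a) + \<theta>)"
  shows "ennreal (LINT x|\<mu>. (\<phi> x)\<^sup>2) \<le> ennreal r * dirichlet_form \<theta> \<mu> \<phi>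
     + ennreal (2 + 2 * (2 powr (real DIM('a) + \<theta> + 3) / (4 * \<beta> * \<beta> powr (real DIM('a) / \<theta>))
         * T powr (real DIM('a) + \<theta>) * r powr (- (1 + real DIM('a) / \<theta>)))\<^sup>2)
       * ennreal ((LINT x|\<mu>. \<bar>\<phi> x\<bar>)\<^sup>2)"
proof -
  have "\<beta> > 0" by (simp add: \<beta>_def)
  have "K > 0" using \<open>r > 0\<close> by (simp add: K_def)
  obtain t where t: "\<rho>\<^sub>1 \<le> t"
    "\<And>\<rho>. 0 \<le> \<rho> \<Longrightarrow> \<rho> \<le> t \<Longrightarrow> exp (g \<rho>) \<le> K * T powr (real DIM('a) + \<theta>)"
    "\<And>\<rho>. \<rho> \<ge> t \<Longrightarrow> K * \<rho> powr (real DIM('a) + \<theta>) \<le> exp (g \<rho>)"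
    using threshold_radius[OF \<rho>\<^sub>1(1,2) \<open>K > 0\<close> far near] by blast
  define u where "u = (\<beta> * r) powr (1 / \<theta>)"
  define v where "v = unit_ball_vol (real DIM('a)) * (u / 2) ^ DIM('a)"
  have "u > 0" using \<open>\<beta> > 0\<close> \<open>r > 0\<close> by (simp add: u_def)
  have "t > 0" "u \<le> 2 * t" using t(1) \<rho>\<^sub>1 \<rho>\<^sub>0 by (auto simp: u_def)
  have v: "v = 4 * \<beta> * u ^ DIM('a)" by (simp add: v_def \<beta>_def power_divide power_add)
  have ud: "u ^ DIM('a) = \<beta> powr (real DIM('a) / \<theta>) * r powr (real DIM('a) / \<theta>)"
    using \<open>\<beta> > 0\<close> \<open>r > 0\<close> \<open>u > 0\<close>
    by (subst powr_realpow[symmetric]) (auto simp: u_def powr_powr powr_mult)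
  have "u powr \<theta> = \<beta> * r" using \<theta>_pos \<open>\<beta> > 0\<close> \<open>r > 0\<close> by (simp add: u_def powr_powr)
  then have "2 * u powr (real DIM('a) + \<theta>) / v = r / 2"
    using \<open>u > 0\<close> \<open>\<beta> > 0\<close> by (simp add: v powr_add powr_realpow)
  moreover have "4 * (2 powr (real DIM('a) + \<theta>) / K) = r / 2"
    by (simp add: K_def powr_add)
  ultimately have 1: "4 * (2 powr (real DIM('a) + \<theta>) / K) + 2 * u powr (real DIM('a) + \<theta>) / v = r" by simp
  have "K * T powr (real DIM('a) + \<theta>) / v = 2 powr (real DIM('a) + \<theta> + 3) / (4 * \<beta> * \<beta> powr (real DIM('a) / \<theta>))
         * T powr (real DIM('a) + \<theta>) * (1 / (r * r powr (real DIM('a) / \<theta>)))"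
    by (simp add: K_def v ud)
  also have "1 / (r * r powr (real DIM('a) / \<theta>)) = r powr (- (1 + real DIM('a) / \<theta>))"
    using \<open>r > 0\<close> by (simp only: powr_minus_divide powr_add) simp
  finally have 2: "K * T powr (real DIM('a) + \<theta>) / v = 2 powr (real DIM('a) + \<theta> + 3) / (4 * \<beta> * \<beta> powr (real DIM('a) / \<theta>))
         * T powr (real DIM('a) + \<theta>) * r powr (- (1 + real DIM('a) / \<theta>))" .
  have "norm (x - y) powr (real DIM('a) + \<theta>) \<le> 2 powr (real DIM('a) + \<theta>) / K * (exp (V x) + exp (V y))"
    if "norm x > t" for x y :: 'a
    using that \<open>K > 0\<close> by (intro norm_diff_powr_le t(3)) auto
  moreover have "exp (V x) \<le> K * T powr (real DIM('a) + \<theta>)" if "norm x \<le> t" for x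
    unfolding V_radial using that by (intro t(2)) auto
  moreover have "0 \<le> 2 powr (real DIM('a) + \<theta>) / K" using \<open>K > 0\<close> by simp
  ultimately show ?thesis
    using super_poincare_estimate[OF \<phi>, of "2 powr (real DIM('a) + \<theta>) / K" t u "K * T powr (real DIM('a) + \<theta>)" v]
      \<open>t > 0\<close> \<open>u > 0\<close> \<open>u \<le> 2 * t\<close> v_def
    unfolding 1 2 by blast
qed

section \<open>The super Poincare inequality with the prescribed weight\<close>

text \<open>Once \<open>r\<close> exceeds the ordinary Poincare constant, the energy controls the
  variance. The squared mean is at most the squared integral of \<open>\<bar>\<phi>\<bar>\<close>,
  so every rate of at least 1 is enough.\<close>

lemma poincare_imp_super_poincare:
  fixes \<phi> :: "'a \<Rightarrow> real" and w' :: ennreal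
  assumes \<phi>: "\<phi> \<in> borel_measurable borel" "integrable \<mu> (\<lambda>x. (\<phi> x)\<^sup>2)"
    and "r \<ge> 0" and le: "\<And>x y. norm (x - y) powr (real DIM('a) + \<theta>) \<le> r * (exp (V x) + exp (V y))"
    and "1 \<le> w'"
  shows "ennreal (LINT x|\<mu>. (\<phi> x)\<^sup>2) \<le> w' * ennreal ((LINT x|\<mu>. \<bar>\<phi> x\<bar>)\<^sup>2) + ennreal r * dirichlet_form \<theta> \<mu> \<phi>"
proof -
  let ?X = "(LINT x|\<mu>. \<bar>\<phi> x\<bar>)\<^sup>2"
  let ?V = "LINT x|\<mu>. (\<phi> x - (LINT y|\<mu>. \<phi> y))\<^sup>2"
  have "ennreal (LINT x|\<mu>. (\<phi> x)\<^sup>2) \<le> ennreal (?V + ?X)"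
    using square_le_variance[OF \<phi>] by (rule ennreal_leI)
  also have "\<dots> = ennreal ?V + 1 * ennreal ?X" by simp
  also have "\<dots> \<le> ennreal r * dirichlet_form \<theta> \<mu> \<phi> + w' * ennreal ?X"
    using \<open>1 \<le> w'\<close> by (intro add_mono mult_right_mono variance_le_dirichlet[OF \<phi> \<open>r \<ge> 0\<close> le]) auto
  finally show ?thesis by (simp add: add.commute)
qed

text \<open>The constant \<open>C\<close> is so small and \<open>R\<close> so large that the constraint in \<open>super_rate\<close> leaves two
  cases: either \<open>r\<close> exceeds the constant of the ordinary Poincare inequality, or \<open>t\<close> is large and the term
  \<open>local_rate\<close>, of order \<open>exp (g t) powr (2 + d / \<theta>) * r powr (- d / \<theta>)\<close>, dominates what the
  averaging argument requires on the ball of radius \<open>t powr (5/4)\<close>.\<close>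

lemma super_poincare_super_rate:
  "\<exists>C>0. \<exists>R>1. super_poincare \<theta> \<mu> (super_rate \<theta> V (\<lambda>x. C * w (max R (norm x))))"
proof -
  let ?p = "real DIM('a) + \<theta>"
  let ?\<delta> = "real DIM('a) / \<theta>"
  define \<beta> where "\<beta> = unit_ball_vol (real DIM('a)) / 2 ^ (DIM('a) + 2)"
  have "\<beta> > 0" by (simp add: \<beta>_def)
  have "?\<delta> > 0" using \<theta>_pos by simp
  obtain K\<^sub>0 where K\<^sub>0: "K\<^sub>0 > 0" "\<And>\<rho>. 0 \<le> \<rho> \<Longrightarrow> \<rho> powr ?p \<le> K\<^sub>0 * exp (g \<rho>)"
    by (rule exp_ge_powr) blast
  define r\<^sub>0 where "r\<^sub>0 = 2 powr ?p * K\<^sub>0"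
  have "r\<^sub>0 > 0" using K\<^sub>0 by (simp add: r\<^sub>0_def)
  have all_pairs: "norm (x - y) powr ?p \<le> r * (exp (V x) + exp (V y))" if "r\<^sub>0 \<le> r" for x y :: 'a and r
  proof -
    have "norm (x - y) powr ?p \<le> 2 powr ?p / (1 / K\<^sub>0) * (exp (V x) + exp (V y))"
    proof (rule norm_diff_powr_le)
      fix \<rho> assume "\<rho> \<ge> norm x"
      then have "0 \<le> \<rho>" using norm_ge_zero order_trans by blast
      then show "1 / K\<^sub>0 * \<rho> powr ?p \<le> exp (g \<rho>)" using K\<^sub>0 by (simp add: field_simps)
    qed (use K\<^sub>0 in simp)
    also have "\<dots> = r\<^sub>0 * (exp (V x) + exp (V y))" by (simp add: r\<^sub>0_def)
    also have "\<dots> \<le> r * (exp (V x) + exp (V y))" using that by (intro mult_right_mono add_nonneg_nonneg) auto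
    finally show ?thesis .
  qed
  \<comment> \<open>The second entry bounds the averaging scale
    \<open>u = (\<beta> * r) powr (1 / \<theta>)\<close> simultaneously for all
    \<open>r < r\<^sub>0\<close>.\<close>
  define \<rho>\<^sub>1 where "\<rho>\<^sub>1 = max \<rho>\<^sub>0 ((\<beta> * r\<^sub>0) powr (1 / \<theta>))"
  have "\<rho>\<^sub>0 \<le> \<rho>\<^sub>1" "1 \<le> \<rho>\<^sub>1" using \<rho>\<^sub>0 by (auto simp: \<rho>\<^sub>1_def)
  have "\<exists>x\<in>{0..\<rho>\<^sub>1}. \<forall>y\<in>{0..\<rho>\<^sub>1}. g y \<le> g x"
    using continuous_attains_sup[OF compact_Icc _ continuous_on_subset[OF g_cont subset_UNIV]] \<open>1 \<le> \<rho>\<^sub>1\<close>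
    by (metis atLeastatMost_empty_iff order_trans zero_le_one)
  then obtain x\<^sub>1 where "\<forall>y\<in>{0..\<rho>\<^sub>1}. g y \<le> g x\<^sub>1" by blast
  then have x\<^sub>1: "\<And>\<rho>. 0 \<le> \<rho> \<Longrightarrow> \<rho> \<le> \<rho>\<^sub>1 \<Longrightarrow> g \<rho> \<le> g x\<^sub>1" by simp
  define mm where "mm = exp (g 0) powr (1 + ?\<delta>)"
  have "mm > 0" by (simp add: mm_def)
  define \<kappa>\<^sub>2 where "\<kappa>\<^sub>2 = 2 powr (?p + 3) / (4 * \<beta> * \<beta> powr ?\<delta>)"
  have "eventually (\<lambda>t. (\<forall>\<rho>\<ge>t powr (5/4). 2 powr (?p + 3) * w t * \<rho> powr ?p \<le> exp (g \<rho>))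
    \<and> 2 * r\<^sub>0 powr ?\<delta> * mm + 2 * \<kappa>\<^sub>2\<^sup>2 * mm * (t powr (5/2 * ?p) * w t powr (2 + ?\<delta>)) \<le> exp (g t) powr (2 + ?\<delta>)
    \<and> mm \<le> exp (g t) powr (2 + ?\<delta>) * t powr (- ?\<delta>)
    \<and> exp (g x\<^sub>1) * r\<^sub>0 \<le> t \<and> max 2 \<rho>\<^sub>1 \<le> t \<and> 1 \<le> ln t) at_top"
    using \<open>mm > 0\<close> \<open>r\<^sub>0 > 0\<close>
    by (intro eventually_conj eventually_weight_times_powr_le eventually_weight_powr_le eventually_le_exp_powr
        eventually_ge_at_top eventually_compose_ln) auto
  then obtain R where R: "\<And>t. t \<ge> R \<Longrightarrow> (\<forall>\<rho>\<ge>t powr (5/4). 2 powr (?p + 3) * w t * \<rho> powr ?p \<le> exp (g \<rho>))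
    \<and> 2 * r\<^sub>0 powr ?\<delta> * mm + 2 * \<kappa>\<^sub>2\<^sup>2 * mm * (t powr (5/2 * ?p) * w t powr (2 + ?\<delta>)) \<le> exp (g t) powr (2 + ?\<delta>)
    \<and> mm \<le> exp (g t) powr (2 + ?\<delta>) * t powr (- ?\<delta>)
    \<and> exp (g x\<^sub>1) * r\<^sub>0 \<le> t \<and> max 2 \<rho>\<^sub>1 \<le> t \<and> 1 \<le> ln t"
    unfolding eventually_at_top_linorder by blast
  have "R \<ge> 2" "1 \<le> ln R" using R[of R] by auto
  have "w R > 0" by (rule weight_pos) fact
  \<comment> \<open>The bound by 1 gives \<open>C * w t \<le> w t\<close>. The other entry makes
    \<open>\<omega>\<close> at most \<open>2 / r\<^sub>0\<close> on the ball of radius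
    \<open>R\<close>, so that a choice \<open>t \<le> R\<close> is admissible only for
    \<open>r \<ge> r\<^sub>0\<close>.\<close>
  define C where "C = min 1 (2 / (r\<^sub>0 * w R))"
  have "C > 0" "C \<le> 1" using \<open>r\<^sub>0 > 0\<close> \<open>w R > 0\<close> by (auto simp: C_def)
  have C: "C * w R \<le> 2 / r\<^sub>0"
  proof -
    have "C * w R \<le> 2 / (r\<^sub>0 * w R) * w R"
      using \<open>w R > 0\<close> by (intro mult_right_mono) (auto simp: C_def)
    then show ?thesis using \<open>w R > 0\<close> by simp
  qed
  define \<omega> where "\<omega> x = C * w (max R (norm x))" for x :: 'a
  define I where "I t = (INF x\<in>{x. norm x \<ge> t}. ennreal (\<omega> x))" for t
  define A where "A r = {(t, s). t > 0 \<and> s > 0 \<and> 2 / I t + ennreal s \<le> ennreal r}" for r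
  define val where "val = (\<lambda>(t, s). 2 * (\<integral>\<^sup>+x. ennreal (\<omega> x) \<partial>\<mu>) / I t + local_rate \<theta> V t (min t s))"
  have rate: "super_rate \<theta> V \<omega> r = (INF z\<in>A r. val z)" for r
    unfolding super_rate_def I_def[symmetric] A_def[symmetric] gibbs_eq val_def ..
  have \<omega>_fin: "(\<integral>\<^sup>+x. ennreal (\<omega> x) \<partial>\<mu>) < \<infinity>"
    unfolding \<omega>_def using \<open>C > 0\<close> \<open>1 \<le> ln R\<close> \<open>R \<ge> 2\<close> by (intro nn_integral_weight) auto
  have fin: "super_rate \<theta> V \<omega> r < \<infinity>" if "r > 0" for r
  proof -
    \<comment> \<open>The level is chosen so that \<open>\<omega> \<ge> 4 / r\<close> beyond
      \<open>t\<close>: then \<open>2 / I t\<close> takes half of \<open>r\<close>, and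
      \<open>s = r / 2\<close> the rest.\<close>
    have "eventually (\<lambda>t. 4 / (C * r) \<le> w t \<and> R \<le> t) at_top"
      by (intro eventually_conj eventually_weight_ge eventually_ge_at_top)
    then obtain t where t: "\<And>x. x \<ge> t \<Longrightarrow> 4 / (C * r) \<le> w x \<and> R \<le> x"
      unfolding eventually_at_top_linorder by blast
    have I: "ennreal (4 / r) \<le> I t"
      unfolding I_def
    proof (intro INF_greatest ennreal_leI)
      fix x :: 'a assume "x \<in> {x. t \<le> norm x}"
      then have "4 / (C * r) \<le> w (norm x)" "R \<le> norm x" using t by auto
      then show "4 / r \<le> \<omega> x" using \<open>C > 0\<close> \<open>r > 0\<close> by (simp add: \<omega>_def max_def field_simps)
    qed
    then have "0 < I t" using \<open>r > 0\<close> by (auto intro: less_le_trans[rotated])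
    have "2 = ennreal (4 / r) * ennreal (r / 2)"
      using \<open>r > 0\<close> by (simp add: ennreal_mult[symmetric])
    also have "\<dots> \<le> I t * ennreal (r / 2)" using I by (rule mult_right_mono) simp
    finally have "2 / I t \<le> ennreal (r / 2)"
      using \<open>0 < I t\<close> by (intro divide_le_posI_ennreal)
    then have "2 / I t + ennreal (r / 2) \<le> ennreal (r / 2) + ennreal (r / 2)" by (rule add_right_mono)
    also have "\<dots> = ennreal r" using \<open>r > 0\<close> by (simp flip: ennreal_plus)
    finally have "(t, r / 2) \<in> A r" using t[of t] \<open>R \<ge> 2\<close> \<open>r > 0\<close> by (auto simp: A_def)
    then have "super_rate \<theta> V \<omega> r \<le> val (t, r / 2)" unfolding rate by (rule INF_lower)
    also have "\<dots> < \<infinity>"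
      unfolding val_def split using \<omega>_fin \<open>0 < I t\<close> t[of t] \<open>R \<ge> 2\<close> \<open>r > 0\<close> local_rate_radial(2)[of t "min t (r / 2)"]
      by (auto simp: ennreal_divide_eq_top_iff ennreal_mult_eq_top_iff less_top[symmetric])
    finally show ?thesis .
  qed
  have step: "ennreal (LINT x|\<mu>. (\<phi> x)\<^sup>2) \<le> val z * ennreal ((LINT x|\<mu>. \<bar>\<phi> x\<bar>)\<^sup>2) + ennreal r * dirichlet_form \<theta> \<mu> \<phi>"
    if "r > 0" "z \<in> A r" and \<phi>: "\<phi> \<in> borel_measurable borel" "integrable \<mu> (\<lambda>x. (\<phi> x)\<^sup>2)" for r z \<phi>
  proof -
    obtain t s where z: "z = (t, s)" "t > 0" "s > 0" and ts: "2 / I t + ennreal s \<le> ennreal r"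
      using \<open>z \<in> A r\<close> by (auto simp: A_def)
    obtain e\<^sub>t :: 'a where "norm e\<^sub>t = t" using \<open>t > 0\<close> vector_choose_size[of t] by auto
    then have "I t \<le> ennreal (\<omega> e\<^sub>t)" unfolding I_def by (intro INF_lower) auto
    moreover have "I t \<noteq> 0" using ts by (auto simp: top_unique)
    ultimately obtain i where i: "I t = ennreal i" "i > 0"
      by (cases "I t") (auto simp: top_unique zero_less_iff_neq_zero)
    have "ennreal (2 / i + s) \<le> ennreal r"
      using ts i \<open>s > 0\<close> divide_ennreal[of 2 i] by simp
    then have "2 / i + s \<le> r" using \<open>r > 0\<close> by (subst (asm) ennreal_le_iff) auto
    then have ir: "2 / i \<le> r" "s \<le> r" using \<open>s > 0\<close> i by (smt (verit) divide_pos_pos)+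
    have i_le: "i \<le> \<omega> x" if "t \<le> norm x" for x
    proof -
      have "I t \<le> ennreal (\<omega> x)" unfolding I_def using that by (intro INF_lower) auto
      moreover have "0 \<le> \<omega> x" using \<open>C > 0\<close> by (simp add: \<omega>_def weight_def)
      ultimately show ?thesis unfolding i(1) by (subst (asm) ennreal_le_iff)
    qed
    \<comment> \<open>The bound on the local rate decreases in its second argument, so it may be
      evaluated at any convenient \<open>\<sigma> \<ge> min t s\<close>: at \<open>t\<close> when
      \<open>r\<close> is large, and at \<open>r \<ge> s\<close> when \<open>r\<close> is
      small.\<close>
    have lower: "ennreal (exp (g t) powr (2 + ?\<delta>) / mm * \<sigma> powr (- ?\<delta>)) \<le> val z" if "min t s \<le> \<sigma>" for \<sigma>
    proof -
      have "\<sigma> powr (- ?\<delta>) \<le> min t s powr (- ?\<delta>)"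
        using that z \<open>?\<delta> > 0\<close> by (intro powr_mono2') auto
      then have "exp (g t) powr (2 + ?\<delta>) / mm * \<sigma> powr (- ?\<delta>) \<le> exp (g t) powr (2 + ?\<delta>) / mm * min t s powr (- ?\<delta>)"
        using \<open>mm > 0\<close> by (intro mult_left_mono) auto
      also have "\<dots> = exp (g t) powr (2 + ?\<delta>) * exp (g 0) powr - (1 + ?\<delta>) * min t s powr (- ?\<delta>)"
        unfolding mm_def powr_minus_divide[of _ "1 + ?\<delta>"] by simp
      finally have "ennreal (exp (g t) powr (2 + ?\<delta>) / mm * \<sigma> powr (- ?\<delta>))
          \<le> ennreal (exp (g t) powr (2 + ?\<delta>) * exp (g 0) powr - (1 + ?\<delta>) * min t s powr (- ?\<delta>))"
        by (rule ennreal_leI)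
      also have "\<dots> \<le> local_rate \<theta> V t (min t s)"
        using z by (intro local_rate_radial(1)) simp_all
      also have "\<dots> \<le> val z" by (simp add: val_def z)
      finally show ?thesis .
    qed
    consider "t \<le> R" | "R < t" "r\<^sub>0 \<le> r" | "R < t" "r < r\<^sub>0" by linarith
    then show ?thesis
    proof cases
      case 1
      obtain e :: 'a where e: "norm e = R" using \<open>R \<ge> 2\<close> vector_choose_size[of R] by auto
      then have "i \<le> 2 / r\<^sub>0" using i_le[of e] 1 C by (simp add: \<omega>_def)
      then have "r\<^sub>0 \<le> 2 / i" using i \<open>r\<^sub>0 > 0\<close> by (simp add: field_simps)
      then have "r\<^sub>0 \<le> r" using ir by simp
      have "I t = (\<integral>\<^sup>+x. I t \<partial>\<mu>)" using emeasure_space_1 by simp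
      also have "\<dots> \<le> (\<integral>\<^sup>+x. ennreal (\<omega> x) \<partial>\<mu>)"
      proof (intro nn_integral_mono)
        fix x
        have "i \<le> \<omega> x"
        proof (cases "t \<le> norm x")
          case False
          then have "\<omega> x = \<omega> e" using 1 e by (simp add: \<omega>_def)
          then show ?thesis using i_le[of e] 1 e by simp
        qed (rule i_le)
        then show "I t \<le> ennreal (\<omega> x)" unfolding i by (rule ennreal_leI)
      qed
      finally have "I t / I t \<le> (\<integral>\<^sup>+x. ennreal (\<omega> x) \<partial>\<mu>) / I t" by (rule divide_right_mono_ennreal)
      then have "1 \<le> (\<integral>\<^sup>+x. ennreal (\<omega> x) \<partial>\<mu>) / I t"
        using i by simp
      also have "\<dots> \<le> 2 * (\<integral>\<^sup>+x. ennreal (\<omega> x) \<partial>\<mu>) / I t"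
        by (intro divide_right_mono_ennreal) (simp add: mult_2)
      also have "\<dots> \<le> val z" by (simp add: val_def z)
      finally have "1 \<le> val z" .
      then show ?thesis
        using \<open>r > 0\<close> by (intro poincare_imp_super_poincare[OF \<phi> _ all_pairs[OF \<open>r\<^sub>0 \<le> r\<close>]]) auto
    next
      case 2
      have "1 \<le> exp (g t) powr (2 + ?\<delta>) / mm * t powr (- ?\<delta>)"
        using R[of t] 2 \<open>mm > 0\<close> by (simp add: field_simps)
      then have "1 \<le> ennreal (exp (g t) powr (2 + ?\<delta>) / mm * t powr (- ?\<delta>))" by (simp only: ennreal_1[symmetric]) (rule ennreal_leI)
      also have "\<dots> \<le> val z" by (rule lower) simp
      finally have "1 \<le> val z" .
      then show ?thesis
        using \<open>r > 0\<close> by (intro poincare_imp_super_poincare[OF \<phi> _ all_pairs[OF \<open>r\<^sub>0 \<le> r\<close>]]) auto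
    next
      case 3
      have Rt: "\<And>\<rho>. \<rho> \<ge> t powr (5/4) \<Longrightarrow> 2 powr (?p + 3) * w t * \<rho> powr ?p \<le> exp (g \<rho>)"
        "2 * r\<^sub>0 powr ?\<delta> * mm + 2 * \<kappa>\<^sub>2\<^sup>2 * mm * (t powr (5/2 * ?p) * w t powr (2 + ?\<delta>)) \<le> exp (g t) powr (2 + ?\<delta>)"
        "exp (g x\<^sub>1) * r\<^sub>0 \<le> t" "\<rho>\<^sub>1 \<le> t" "2 \<le> t" "1 \<le> ln t"
        using R[of t] 3 by auto
      have "w t > 0" by (rule weight_pos) fact
      have "i \<le> C * w t" using i_le[of e\<^sub>t] \<open>norm e\<^sub>t = t\<close> 3 by (simp add: \<omega>_def)
      also have "\<dots> \<le> w t" using \<open>C \<le> 1\<close> \<open>w t > 0\<close> by simp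
      finally have "i \<le> w t" .
      \<comment> \<open>The constraint read backwards: a small \<open>r\<close> forces a large
        weight at \<open>t\<close>. This is what converts powers of \<open>1 / r\<close> into powers
        of \<open>w t\<close>.\<close>
      have "1 / r \<le> i"
      proof -
        have "2 \<le> r * i" using ir i by (simp add: field_simps)
        then show ?thesis using \<open>r > 0\<close> by (simp add: field_simps)
      qed
      then have rw: "1 / r \<le> w t" using \<open>i \<le> w t\<close> by simp
      define T where "T = t powr (5/4)"
      have "t powr 1 \<le> T" unfolding T_def using \<open>2 \<le> t\<close> by (intro powr_mono) auto
      then have "t \<le> T" using \<open>2 \<le> t\<close> by simp
      have "t powr 1 \<le> T powr ?p"
      proof -
        have "t powr 1 \<le> t powr ?p" using \<open>2 \<le> t\<close> d_ge \<theta>_pos by (intro powr_mono) linarith+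
        also have "\<dots> \<le> T powr ?p" using \<open>2 \<le> t\<close> \<open>t \<le> T\<close> \<theta>_pos by (intro powr_mono2) auto
        finally show ?thesis .
      qed
      then have "t \<le> T powr ?p" using \<open>2 \<le> t\<close> by simp
      have est: "ennreal (LINT x|\<mu>. (\<phi> x)\<^sup>2) \<le> ennreal r * dirichlet_form \<theta> \<mu> \<phi>
         + ennreal (2 + 2 * (\<kappa>\<^sub>2 * T powr ?p * r powr (- (1 + ?\<delta>)))\<^sup>2) * ennreal ((LINT x|\<mu>. \<bar>\<phi> x\<bar>)\<^sup>2)"
        unfolding \<kappa>\<^sub>2_def \<beta>_def
      proof (rule super_poincare_estimate_radial[OF \<phi> \<open>r > 0\<close> \<open>\<rho>\<^sub>0 \<le> \<rho>\<^sub>1\<close>])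
        show "\<rho>\<^sub>1 \<le> T" using \<open>\<rho>\<^sub>1 \<le> t\<close> \<open>t \<le> T\<close> by simp
        have "(\<beta> * r) powr (1 / \<theta>) \<le> (\<beta> * r\<^sub>0) powr (1 / \<theta>)"
          using 3 \<open>\<beta> > 0\<close> \<open>r > 0\<close> \<theta>_pos by (intro powr_mono2 mult_left_mono) auto
        then show "(unit_ball_vol (real DIM('a)) / 2 ^ (DIM('a) + 2) * r) powr (1 / \<theta>) \<le> \<rho>\<^sub>1"
          unfolding \<beta>_def[symmetric] by (simp add: \<rho>\<^sub>1_def)
      next
        fix \<rho> assume "T \<le> \<rho>"
        have "2 powr (?p + 3) / r * \<rho> powr ?p = 2 powr (?p + 3) * (1 / r) * \<rho> powr ?p" by simp
        also have "\<dots> \<le> 2 powr (?p + 3) * w t * \<rho> powr ?p"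
          using rw by (intro mult_right_mono mult_left_mono) auto
        also have "\<dots> \<le> exp (g \<rho>)" using \<open>T \<le> \<rho>\<close> by (intro Rt(1)) (simp add: T_def)
        finally show "2 powr (?p + 3) / r * \<rho> powr ?p \<le> exp (g \<rho>)" .
      next
        fix \<rho> assume "0 \<le> \<rho>" "\<rho> \<le> \<rho>\<^sub>1"
        have "exp (g \<rho>) * r \<le> exp (g x\<^sub>1) * r\<^sub>0"
          using x\<^sub>1[OF \<open>0 \<le> \<rho>\<close> \<open>\<rho> \<le> \<rho>\<^sub>1\<close>] 3 \<open>r > 0\<close> by (intro mult_mono) auto
        also have "\<dots> \<le> 1 * T powr ?p" using Rt(3) \<open>t \<le> T powr ?p\<close> by simp
        also have "\<dots> \<le> 2 powr (?p + 3) * T powr ?p"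
          using \<theta>_pos by (intro mult_right_mono ge_one_powr_ge_zero) auto
        finally show "exp (g \<rho>) \<le> 2 powr (?p + 3) / r * T powr ?p"
          using \<open>r > 0\<close> by (simp add: field_simps)
      qed
      \<comment> \<open>Squaring produces \<open>r powr (- 2 - 2 * d / \<theta>)\<close>. One factor
        \<open>r powr (- d / \<theta>)\<close> is set aside to match the local rate at
        \<open>\<sigma> = r\<close>; the remaining \<open>(1 / r) powr (2 + d / \<theta>)\<close> is
        bounded through \<open>w t\<close>.\<close>
      have "2 + 2 * (\<kappa>\<^sub>2 * T powr ?p * r powr (- (1 + ?\<delta>)))\<^sup>2 \<le> exp (g t) powr (2 + ?\<delta>) / mm * r powr (- ?\<delta>)"
      proof -
        have "(T powr ?p)\<^sup>2 = t powr (5/2 * ?p)"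
          using \<open>2 \<le> t\<close> by (simp add: T_def powr_powr power2_eq_square flip: powr_add)
        moreover have "(r powr (- (1 + ?\<delta>)))\<^sup>2 = (1 / r) powr (2 + ?\<delta>) * r powr (- ?\<delta>)"
        proof -
          have "(1 / r) powr (2 + ?\<delta>) = r powr (- (2 + ?\<delta>))"
            using \<open>r > 0\<close> powr_divide[of 1 r "2 + ?\<delta>"] powr_minus_divide[of r "2 + ?\<delta>"] by simp
          then show ?thesis
            unfolding power2_eq_square by (simp flip: powr_add add: algebra_simps)
        qed
        moreover have "r powr ?\<delta> * r powr (- ?\<delta>) = 1"
          using \<open>r > 0\<close> by (simp add: powr_minus)
        moreover have "2 + 2 * (k * X * Y)\<^sup>2 = (2 * a + 2 * k\<^sup>2 * (X' * Z)) * b"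
          if "X\<^sup>2 = X'" "Y\<^sup>2 = Z * b" "a * b = 1" for k X X' Y Z a b :: real
          using that by (simp add: power_mult_distrib distrib_right mult.assoc)
        ultimately have "2 + 2 * (\<kappa>\<^sub>2 * T powr ?p * r powr (- (1 + ?\<delta>)))\<^sup>2
          = (2 * r powr ?\<delta> + 2 * \<kappa>\<^sub>2\<^sup>2 * (t powr (5/2 * ?p) * (1 / r) powr (2 + ?\<delta>))) * r powr (- ?\<delta>)"
          by blast
        also have "\<dots> \<le> exp (g t) powr (2 + ?\<delta>) / mm * r powr (- ?\<delta>)"
        proof (rule mult_right_mono)
          have "r powr ?\<delta> \<le> r\<^sub>0 powr ?\<delta>" using 3 \<open>r > 0\<close> \<open>?\<delta> > 0\<close> by (intro powr_mono2) auto
          moreover have "(1 / r) powr (2 + ?\<delta>) \<le> w t powr (2 + ?\<delta>)"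
            using rw \<open>r > 0\<close> \<open>?\<delta> > 0\<close> by (intro powr_mono2) auto
          ultimately have "2 * r powr ?\<delta> + 2 * \<kappa>\<^sub>2\<^sup>2 * (t powr (5/2 * ?p) * (1 / r) powr (2 + ?\<delta>))
            \<le> 2 * r\<^sub>0 powr ?\<delta> + 2 * \<kappa>\<^sub>2\<^sup>2 * (t powr (5/2 * ?p) * w t powr (2 + ?\<delta>))"
            by (intro add_mono mult_left_mono) auto
          also have "\<dots> \<le> exp (g t) powr (2 + ?\<delta>) / mm"
          proof -
            have "(2 * r\<^sub>0 powr ?\<delta> + 2 * \<kappa>\<^sub>2\<^sup>2 * (t powr (5/2 * ?p) * w t powr (2 + ?\<delta>))) * mm \<le> exp (g t) powr (2 + ?\<delta>)"
            proof -
              have "(2 * a + 2 * k * b) * mm = 2 * a * mm + 2 * k * mm * b" for a k b :: real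
                by (simp add: distrib_right)
              then show ?thesis using Rt(2) by simp
            qed
            then show ?thesis using \<open>mm > 0\<close> by (simp only: pos_le_divide_eq)
          qed
          finally show "2 * r powr ?\<delta> + 2 * \<kappa>\<^sub>2\<^sup>2 * (t powr (5/2 * ?p) * (1 / r) powr (2 + ?\<delta>))
             \<le> exp (g t) powr (2 + ?\<delta>) / mm" .
        qed simp
        finally show ?thesis .
      qed
      then have "ennreal (2 + 2 * (\<kappa>\<^sub>2 * T powr ?p * r powr (- (1 + ?\<delta>)))\<^sup>2) \<le> val z"
        by (rule order_trans[OF ennreal_leI lower]) (use ir(2) in simp)
      then have "ennreal r * dirichlet_form \<theta> \<mu> \<phi>
         + ennreal (2 + 2 * (\<kappa>\<^sub>2 * T powr ?p * r powr (- (1 + ?\<delta>)))\<^sup>2) * ennreal ((LINT x|\<mu>. \<bar>\<phi> x\<bar>)\<^sup>2)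
         \<le> ennreal r * dirichlet_form \<theta> \<mu> \<phi> + val z * ennreal ((LINT x|\<mu>. \<bar>\<phi> x\<bar>)\<^sup>2)"
        by (intro add_left_mono mult_right_mono) auto
      from order_trans[OF est this] show ?thesis by (simp only: add.commute)
    qed
  qed
  have "super_poincare \<theta> \<mu> (super_rate \<theta> V \<omega>)"
    unfolding super_poincare_def
  proof (intro allI impI conjI ballI)
    fix r :: real assume "r > 0"
    show "super_rate \<theta> V \<omega> r < \<infinity>" using \<open>r > 0\<close> by (rule fin)
    fix \<phi> assume "\<phi> \<in> dirichlet_domain \<theta> \<mu>"
    then have \<phi>: "\<phi> \<in> borel_measurable borel" "integrable \<mu> (\<lambda>x. (\<phi> x)\<^sup>2)" and E: "dirichlet_form \<theta> \<mu> \<phi> < \<infinity>"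
      by (auto simp: dirichlet_domain_def)
    \<comment> \<open>An infimum over the empty set would be \<open>\<infinity>\<close>, so
      finiteness of the rate already yields an admissible pair.\<close>
    have "A r \<noteq> {}" using fin[OF \<open>r > 0\<close>] by (auto simp: rate)
    moreover have "ennreal r * dirichlet_form \<theta> \<mu> \<phi> < \<infinity>" using E by (simp add: ennreal_mult_less_top)
    ultimately have "ennreal (LINT x|\<mu>. (\<phi> x)\<^sup>2) \<le> (INF z\<in>A r. val z) * ennreal ((LINT x|\<mu>. \<bar>\<phi> x\<bar>)\<^sup>2) + ennreal r * dirichlet_form \<theta> \<mu> \<phi>"
      by (intro le_INF_mult_add step[OF \<open>r > 0\<close> _ \<phi>]) auto
    then show "ennreal (LINT x|\<mu>. (\<phi> x)\<^sup>2) \<le> ennreal r * dirichlet_form \<theta> \<mu> \<phi>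
       + super_rate \<theta> V \<omega> r * ennreal ((LINT x|\<mu>. \<bar>\<phi> x\<bar>)\<^sup>2)"
      by (simp add: rate add.commute)
  qed
  then show ?thesis
    unfolding \<omega>_def[abs_def] using \<open>C > 0\<close> \<open>R \<ge> 2\<close> by (intro exI[of _ C] exI[of _ R] conjI) auto
qed

end

section \<open>Dissipative profiles\<close>

lemma twice_cont_diff_has_real_derivative:
  assumes "twice_cont_diff f"
  shows "(f has_real_derivative deriv f x) (at x)"
proof -
  have "f differentiable (at x)"
    using assms unfolding twice_cont_diff_def C1_differentiable_on_eq by auto
  then show ?thesis by (simp add: DERIV_deriv_iff_real_differentiable)
qed

text \<open>Put \<open>\<rho> = \<psi> r\<close>, so that
  \<open>l = ln \<rho> = b * r powr \<beta>\<close> and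
  \<open>deriv \<psi> r * r = \<rho> * \<beta> * l\<close>. The bound is the dissipativity condition
  divided by \<open>\<rho> * \<beta> * l\<close>.\<close>

lemma dissipative_deriv_bound:
  fixes f \<psi> :: "real \<Rightarrow> real"
  assumes "1 < \<beta>" and "b > 0"
    and \<psi>: "\<And>r. r \<ge> b powr (- (1 / \<beta>)) \<Longrightarrow> \<psi> r = exp (b * r powr \<beta>)"
    and diss: "dissipative TYPE('a::euclidean_space) b \<beta> \<psi> f \<alpha> A B"
  shows "eventually (\<lambda>\<rho>. A / \<beta> * b powr - (\<alpha> / \<beta>) * ln \<rho> powr (\<alpha> / \<beta> - 1) / \<rho> + real DIM('a) / \<rho>
      - (B + real DIM('a)) / \<beta> / (ln \<rho> * \<rho>) \<le> deriv f \<rho>) at_top"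
proof -
  let ?d = "real DIM('a)"
  obtain N where "N > 0" and N: "\<And>x::'a. norm x > N \<Longrightarrow>
        deriv f (\<psi> (norm x)) * deriv \<psi> (norm x) * norm x
          - b * \<beta> * ?d * norm x powr \<beta> + (?d - \<beta>) > A * norm x powr \<alpha> - B"
    using diss by (auto simp: dissipative_def)
  \<comment> \<open>Beyond \<open>M\<close> the dissipativity condition holds and
    \<open>\<psi>\<close> is the given exponential. Strict inequality \<open>r > M\<close> places
    \<open>r\<close> in an open set of such points, which determines
    \<open>deriv \<psi> r\<close>.\<close>
  define M where "M = max N (b powr (- (1 / \<beta>)))"
  have "M > 0" using \<open>N > 0\<close> by (simp add: M_def)
  have "eventually (\<lambda>\<rho>. b * M powr \<beta> + 1 \<le> ln \<rho>) at_top"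
    by (intro eventually_compose_ln eventually_ge_at_top)
  with eventually_gt_at_top[of 0] show ?thesis
  proof eventually_elim
    case (elim \<rho>)
    define l where "l = ln \<rho>"
    define r where "r = (l / b) powr (1 / \<beta>)"
    have "l > 0" using elim \<open>b > 0\<close> \<open>M > 0\<close> by (simp add: l_def add_nonneg_pos less_le_trans[of _ "b * M powr \<beta> + 1"])
    have "M powr \<beta> < l / b" using elim \<open>b > 0\<close> by (simp add: l_def field_simps)
    then have "(M powr \<beta>) powr (1 / \<beta>) < r"
      unfolding r_def using \<open>1 < \<beta>\<close> by (intro powr_less_mono2) auto
    then have "M < r" using \<open>1 < \<beta>\<close> \<open>M > 0\<close> by (simp add: powr_powr)
    then have r: "r > N" "r > b powr (- (1 / \<beta>))" "r > 0" using \<open>M > 0\<close> by (auto simp: M_def)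
    have r\<beta>: "r powr \<beta> = l / b" using \<open>1 < \<beta>\<close> \<open>l > 0\<close> \<open>b > 0\<close> by (simp add: r_def powr_powr)
    have r\<alpha>: "r powr \<alpha> = l powr (\<alpha> / \<beta>) * b powr - (\<alpha> / \<beta>)"
      using \<open>l > 0\<close> \<open>b > 0\<close> by (simp add: r_def powr_powr powr_divide powr_minus_divide)
    have \<psi>_r: "\<psi> r = \<rho>"
      using \<psi>[of r] r r\<beta> \<open>b > 0\<close> elim by (simp add: l_def)
    have "((\<lambda>r. exp (b * r powr \<beta>)) has_real_derivative \<rho> * (b * (\<beta> * r powr (\<beta> - 1)))) (at r)"
      using r r\<beta> \<open>b > 0\<close> elim
      by (auto intro!: derivative_eq_intros simp: l_def)
    then have "(\<psi> has_real_derivative \<rho> * (b * (\<beta> * r powr (\<beta> - 1)))) (at r)"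
      by (rule has_field_derivative_transform_within_open[where S = "{b powr (- (1 / \<beta>))<..}"])
        (use r \<psi> in auto)
    then have "deriv \<psi> r = \<rho> * (b * (\<beta> * r powr (\<beta> - 1)))" by (rule DERIV_imp_deriv)
    then have "deriv \<psi> r * r = \<rho> * b * \<beta> * (r powr (\<beta> - 1) * r powr 1)" using r by simp
    also have "r powr (\<beta> - 1) * r powr 1 = l / b" unfolding powr_add[symmetric] using r\<beta> by simp
    finally have d\<psi>: "deriv \<psi> r * r = \<rho> * \<beta> * l" using \<open>b > 0\<close> by simp
    obtain x :: 'a where "norm x = r" using r vector_choose_size[of r] by auto
    then have "deriv f \<rho> * (deriv \<psi> r * r) - b * \<beta> * ?d * (l / b) + (?d - \<beta>) > A * r powr \<alpha> - B"
      using N[of x] r \<psi>_r r\<beta> by (simp add: mult.assoc)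
    \<comment> \<open>A positive summand \<open>\<beta>\<close> is given up on the left; this is the
      origin of \<open>B + d\<close> in the coefficient of the iterated logarithm.\<close>
    then have "A * (l powr (\<alpha> / \<beta>) * b powr - (\<alpha> / \<beta>)) + \<beta> * ?d * l - (B + ?d) \<le> deriv f \<rho> * (\<rho> * \<beta> * l)"
      using \<open>b > 0\<close> \<open>1 < \<beta>\<close> by (simp add: d\<psi> r\<alpha>)
    then have "(A * (l powr (\<alpha> / \<beta>) * b powr - (\<alpha> / \<beta>)) + \<beta> * ?d * l - (B + ?d)) / (\<rho> * \<beta> * l) \<le> deriv f \<rho>"
      using \<open>l > 0\<close> \<open>1 < \<beta>\<close> elim by (subst pos_divide_le_eq) auto
    moreover have "l powr (\<alpha> / \<beta>) = l powr (\<alpha> / \<beta> - 1) * l"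
      using \<open>l > 0\<close> powr_add[of l "\<alpha> / \<beta> - 1" 1] by simp
    ultimately show ?case
      using \<open>l > 0\<close> \<open>1 < \<beta>\<close> elim
      by (simp add: l_def[symmetric] add_divide_distrib diff_divide_distrib ac_simps)
  qed
qed

text \<open>\<open>G\<close> is \<open>f\<close> minus an antiderivative of the lower bound on its
  derivative, hence nondecreasing, and \<open>G \<rho>\<^sub>0\<close> serves as \<open>c\<close>.
  Beyond \<open>\<rho>\<^sub>0\<close> also \<open>k \<le> ln \<rho>\<close>, so
  \<open>d / \<rho>\<close> outweighs the negative term and \<open>f\<close> itself is
  monotone.\<close>

lemma dissipative_profile_bound:
  fixes f \<psi> :: "real \<Rightarrow> real"
  assumes "1 < \<beta>" and "b > 0"
    and \<psi>: "\<And>r. r \<ge> b powr (- (1 / \<beta>)) \<Longrightarrow> \<psi> r = exp (b * r powr \<beta>)"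
    and "twice_cont_diff f"
    and diss: "dissipative TYPE('a::euclidean_space) b \<beta> \<psi> f \<alpha> A B"
  obtains \<rho>\<^sub>0 c where "1 \<le> \<rho>\<^sub>0" "1 \<le> ln \<rho>\<^sub>0" "\<And>x y. \<rho>\<^sub>0 \<le> x \<Longrightarrow> x \<le> y \<Longrightarrow> f x \<le> f y"
    "\<And>\<rho>. \<rho>\<^sub>0 \<le> \<rho> \<Longrightarrow> c + A / \<alpha> * b powr - (\<alpha> / \<beta>) * ln \<rho> powr (\<alpha> / \<beta>) + real DIM('a) * ln \<rho>
      - (B + real DIM('a)) / \<beta> * ln (ln \<rho>) \<le> f \<rho>"
proof -
  let ?d = "real DIM('a)"
  define k where "k = (B + ?d) / \<beta>"
  define \<kappa> where "\<kappa> = A / \<alpha> * b powr - (\<alpha> / \<beta>)"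
  have "A > 0" "B > 0" "\<alpha> \<ge> 1" using diss by (auto simp: dissipative_def)
  have \<kappa>: "\<kappa> * (\<alpha> / \<beta>) = A / \<beta> * b powr - (\<alpha> / \<beta>)" using \<open>\<alpha> \<ge> 1\<close> by (simp add: \<kappa>_def)
  have "\<kappa> > 0" using \<open>A > 0\<close> \<open>\<alpha> \<ge> 1\<close> \<open>b > 0\<close> by (simp add: \<kappa>_def)
  have f': "(f has_real_derivative deriv f x) (at x)" for x
    by (rule twice_cont_diff_has_real_derivative) fact
  have "eventually (\<lambda>\<rho>. \<kappa> * (\<alpha> / \<beta>) * ln \<rho> powr (\<alpha> / \<beta> - 1) / \<rho> + ?d / \<rho> - k / (ln \<rho> * \<rho>) \<le> deriv f \<rho>
      \<and> 1 \<le> ln \<rho> \<and> k \<le> ln \<rho> \<and> 1 \<le> \<rho>) at_top"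
    unfolding \<kappa> k_def using assms
    by (intro eventually_conj dissipative_deriv_bound eventually_compose_ln eventually_ge_at_top) auto
  then obtain \<rho>\<^sub>0 where \<rho>\<^sub>0: "\<And>\<rho>. \<rho> \<ge> \<rho>\<^sub>0 \<Longrightarrow>
      \<kappa> * (\<alpha> / \<beta>) * ln \<rho> powr (\<alpha> / \<beta> - 1) / \<rho> + ?d / \<rho> - k / (ln \<rho> * \<rho>) \<le> deriv f \<rho>
      \<and> 1 \<le> ln \<rho> \<and> k \<le> ln \<rho> \<and> 1 \<le> \<rho>"
    unfolding eventually_at_top_linorder by blast
  have nonneg: "deriv f \<rho> \<ge> 0" if "\<rho> \<ge> \<rho>\<^sub>0" for \<rho>
  proof -
    have \<rho>: "1 \<le> ln \<rho>" "k \<le> ln \<rho>" "1 \<le> \<rho>" using \<rho>\<^sub>0[OF that] by auto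
    have "k / ln \<rho> \<le> 1" using \<rho> by (subst divide_le_eq_1_pos) linarith+
    also have "1 \<le> ?d" using DIM_positive[where 'a = 'a] by linarith
    finally have "k / ln \<rho> / \<rho> \<le> ?d / \<rho>" using \<rho> by (intro divide_right_mono) auto
    moreover have "0 \<le> \<kappa> * (\<alpha> / \<beta>) * ln \<rho> powr (\<alpha> / \<beta> - 1) / \<rho>"
      using \<open>\<kappa> > 0\<close> \<open>\<alpha> \<ge> 1\<close> \<open>1 < \<beta>\<close> \<rho> by (intro divide_nonneg_nonneg mult_nonneg_nonneg) auto
    moreover have "k / (ln \<rho> * \<rho>) = k / ln \<rho> / \<rho>" by simp
    ultimately show ?thesis using \<rho>\<^sub>0[OF that] by linarith
  qed
  define G where "G \<rho> = f \<rho> - \<kappa> * ln \<rho> powr (\<alpha> / \<beta>) - ?d * ln \<rho> + k * ln (ln \<rho>)" for \<rho>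
  have G_mono: "G \<rho>\<^sub>0 \<le> G \<rho>" if "\<rho>\<^sub>0 \<le> \<rho>" for \<rho>
  proof (rule DERIV_nonneg_imp_nondecreasing[OF that])
    fix x assume "\<rho>\<^sub>0 \<le> x"
    then have x: "1 \<le> ln x" "1 \<le> x"
      "\<kappa> * (\<alpha> / \<beta>) * ln x powr (\<alpha> / \<beta> - 1) / x + ?d / x - k / (ln x * x) \<le> deriv f x"
      using \<rho>\<^sub>0[of x] by auto
    then have "1 < x" by (cases "x = 1") auto
    have "(G has_real_derivative deriv f x - \<kappa> * ((\<alpha> / \<beta>) * ln x powr (\<alpha> / \<beta> - 1) * (1 / x)) - ?d * (1 / x)
        + k * (1 / ln x * (1 / x))) (at x)"
      unfolding G_def using x \<open>1 < x\<close>
      by (auto intro!: derivative_eq_intros f' simp: field_simps)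
    moreover have "0 \<le> deriv f x - \<kappa> * ((\<alpha> / \<beta>) * ln x powr (\<alpha> / \<beta> - 1) * (1 / x)) - ?d * (1 / x)
        + k * (1 / ln x * (1 / x))"
      using x(3) by (simp add: mult.assoc)
    ultimately show "\<exists>y. (G has_real_derivative y) (at x) \<and> 0 \<le> y" by blast
  qed
  show ?thesis
  proof (rule that[of \<rho>\<^sub>0 "G \<rho>\<^sub>0"])
    show "1 \<le> \<rho>\<^sub>0" "1 \<le> ln \<rho>\<^sub>0" using \<rho>\<^sub>0[of \<rho>\<^sub>0] by auto
  next
    fix x y assume xy: "\<rho>\<^sub>0 \<le> x" "x \<le> y"
    show "f x \<le> f y"
    proof (rule DERIV_nonneg_imp_nondecreasing[OF xy(2)])
      fix z assume "x \<le> z"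
      then show "\<exists>d. (f has_real_derivative d) (at z) \<and> 0 \<le> d"
        using f' nonneg[of z] xy(1) by (meson order_trans)
    qed
  next
    fix \<rho> assume "\<rho>\<^sub>0 \<le> \<rho>"
    from G_mono[OF this] show "G \<rho>\<^sub>0 + A / \<alpha> * b powr - (\<alpha> / \<beta>) * ln \<rho> powr (\<alpha> / \<beta>) + ?d * ln \<rho>
      - (B + ?d) / \<beta> * ln (ln \<rho>) \<le> f \<rho>"
      unfolding G_def[of \<rho>] \<kappa>_def k_def by linarith
  qed
qed

text \<open>The integrand vanishes nowhere, so a zero integral would make Lebesgue measure trivial.
  Positivity makes \<open>ln (norm_const F)\<close> a genuine normalization.\<close>

lemma norm_const_pos:
  fixes F :: "'a::euclidean_space \<Rightarrow> real"
  assumes "integrable lborel (\<lambda>x. exp (- F x))"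
  shows "0 < norm_const F"
proof -
  have "norm_const F \<noteq> 0"
  proof
    assume "norm_const F = 0"
    then have "AE x in (lborel :: 'a measure). exp (- F x) = 0"
      using assms by (simp add: norm_const_def integral_nonneg_eq_0_iff_AE)
    then have "emeasure (lborel :: 'a measure) (space lborel) = 0"
      by (simp add: eventually_False ae_filter_eq_bot_iff)
    then show False by simp
  qed
  moreover have "0 \<le> norm_const F" by (simp add: norm_const_def)
  ultimately show ?thesis by simp
qed

theorem proposition2:
  fixes F :: "'a::euclidean_space \<Rightarrow> real" and f \<psi> :: "real \<Rightarrow> real"
    and \<theta> b \<beta> \<alpha> A B :: real
  assumes "1 < \<beta>" and "\<beta> \<le> 2" and "b > 0"
    and "\<And>r. r \<ge> b powr (- (1 / \<beta>)) \<Longrightarrow> \<psi> r = exp (b * r powr \<beta>)"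
    and "twice_cont_diff f"
    and "\<And>x. F x = f (norm x)"
    and "integrable lborel (\<lambda>x. exp (- F x))"
    and "dissipative TYPE('a) b \<beta> \<psi> f \<alpha> A B"
    and "0 < \<theta>" and "\<theta> < 2"
  shows "(\<alpha> > \<beta> \<or> \<alpha> = \<beta> \<and> \<theta> < A / (\<beta> * b) \<longrightarrow>
            (\<exists>C>0. \<exists>R>1. super_poincare \<theta> (gibbs F)
               (super_rate \<theta> (normalized_potential F) (omega \<theta> b \<beta> \<alpha> A B C R)))) \<and>
         (\<alpha> = \<beta> \<and> \<theta> \<ge> A / (\<beta> * b) \<longrightarrow>
            weak_poincare \<theta> (gibbs F) (weak_rate \<theta> (normalized_potential F)))"
proof -
  let ?d = "real DIM('a)"
  let ?V = "normalized_potential F"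
  define Z where "Z = norm_const F"
  have "Z > 0" unfolding Z_def by (rule norm_const_pos) fact
  have "A > 0" "B > 0" "\<alpha> \<ge> 1" using assms(8) by (auto simp: dissipative_def)
  define g where "g \<rho> = f \<rho> + ln Z" for \<rho>
  have V: "?V x = g (norm x)" for x
    by (simp add: normalized_potential_def g_def assms(6) Z_def)
  have exp_V: "exp (- ?V x) = exp (- F x) / Z" for x
    using \<open>Z > 0\<close> by (simp add: normalized_potential_def Z_def[symmetric] exp_diff)
  have f_cont: "continuous_on UNIV f"
    using twice_cont_diff_has_real_derivative[OF assms(5)] by (intro DERIV_continuous_on) auto
  then have g_cont: "continuous_on UNIV g"
    unfolding g_def by (intro continuous_intros)
  have [measurable]: "g \<in> borel_measurable borel"
    using g_cont by (rule borel_measurable_continuous_onI)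
  have V_meas: "?V \<in> borel_measurable borel"
    unfolding V[abs_def] by measurable
  have mass: "(\<integral>\<^sup>+x. ennreal (exp (- ?V x)) \<partial>lborel) = 1"
    unfolding exp_V using assms(7) \<open>Z > 0\<close>
    by (subst nn_integral_eq_integral) (auto simp: Z_def norm_const_def)
  interpret gibbs_potential ?V \<theta>
    using V_meas mass assms(9) by unfold_locales
  have gibbs: "gibbs F = \<mu>"
    unfolding gibbs_def exp_V Z_def ..
  obtain \<rho>\<^sub>0 c where \<rho>\<^sub>0: "1 \<le> \<rho>\<^sub>0" "1 \<le> ln \<rho>\<^sub>0"
    and mono: "\<And>x y. \<rho>\<^sub>0 \<le> x \<Longrightarrow> x \<le> y \<Longrightarrow> f x \<le> f y"
    and lower: "\<And>\<rho>. \<rho>\<^sub>0 \<le> \<rho> \<Longrightarrow> c + A / \<alpha> * b powr - (\<alpha> / \<beta>) * ln \<rho> powr (\<alpha> / \<beta>) + ?d * ln \<rho>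
      - (B + ?d) / \<beta> * ln (ln \<rho>) \<le> f \<rho>"
    using dissipative_profile_bound[OF assms(1,3,4,5,8)] by blast
  have weak: "weak_poincare \<theta> \<mu> (weak_rate \<theta> ?V)"
  proof -
    \<comment> \<open>A minimum on the compact part and monotonicity beyond it bound the potential
      from below on the whole space.\<close>
    have "\<exists>x\<in>{0..\<rho>\<^sub>0}. \<forall>y\<in>{0..\<rho>\<^sub>0}. g x \<le> g y"
      using continuous_attains_inf[OF compact_Icc _ continuous_on_subset[OF g_cont subset_UNIV]] \<rho>\<^sub>0(1)
      by (metis atLeastatMost_empty_iff order_trans zero_le_one)
    then obtain x\<^sub>0 where x\<^sub>0: "\<forall>y\<in>{0..\<rho>\<^sub>0}. g x\<^sub>0 \<le> g y" by blast
    have "exp (g x\<^sub>0) \<le> exp (?V x)" for x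
    proof (cases "norm x \<le> \<rho>\<^sub>0")
      case True
      then show ?thesis using x\<^sub>0 by (simp add: V)
    next
      case False
      then have "g \<rho>\<^sub>0 \<le> g (norm x)" unfolding g_def using mono by simp
      moreover have "g x\<^sub>0 \<le> g \<rho>\<^sub>0" using x\<^sub>0 \<rho>\<^sub>0(1) by simp
      ultimately show ?thesis by (simp add: V)
    qed
    then show ?thesis by (intro weak_poincare_weak_rate[of "exp (g x\<^sub>0)"]) auto
  qed
  have super: "\<exists>C>0. \<exists>R>1. super_poincare \<theta> \<mu> (super_rate \<theta> ?V (omega \<theta> b \<beta> \<alpha> A B C R))"
    if rates: "\<alpha> > \<beta> \<or> \<alpha> = \<beta> \<and> \<theta> < A / (\<beta> * b)"
  proof -
    define \<kappa> where "\<kappa> = A / \<alpha> * b powr - (\<alpha> / \<beta>)"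
    have "\<kappa> > 0" using \<open>A > 0\<close> \<open>\<alpha> \<ge> 1\<close> \<open>b > 0\<close> by (simp add: \<kappa>_def)
    \<comment> \<open>For \<open>\<alpha> = \<beta>\<close> the constant \<open>\<kappa>\<close>
      equals \<open>A / (\<beta> * b)\<close>, so the alternative on the rates is exactly what
      \<open>dominates\<close> asks for.\<close>
    have dom: "1 < \<alpha> / \<beta> \<or> \<theta> < \<kappa>"
      using rates
    proof
      assume "\<alpha> = \<beta> \<and> \<theta> < A / (\<beta> * b)"
      then show ?thesis using \<open>1 < \<beta>\<close> \<open>b > 0\<close> by (simp add: \<kappa>_def powr_minus divide_simps)
    qed (use \<open>1 < \<beta>\<close> in simp)
    interpret radial_gibbs ?V \<theta> g \<rho>\<^sub>0 "c + ln Z" \<kappa> "\<alpha> / \<beta>" "(B + ?d) / \<beta>" "B / \<beta>"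
    proof unfold_locales
      show "c + ln Z + \<kappa> * ln \<rho> powr (\<alpha> / \<beta>) + ?d * ln \<rho> - (B + ?d) / \<beta> * ln (ln \<rho>) \<le> g \<rho>"
        if "\<rho>\<^sub>0 \<le> \<rho>" for \<rho>
        using lower[OF that] unfolding g_def \<kappa>_def by linarith
      show "1 \<le> ?d" using DIM_positive[where 'a = 'a] by linarith
      show "1 \<le> \<alpha> / \<beta>" using rates \<open>1 < \<beta>\<close> by auto
      show "0 \<le> B / \<beta>" using \<open>B > 0\<close> \<open>1 < \<beta>\<close> by auto
    qed (use \<rho>\<^sub>0 g_cont mono \<open>\<kappa> > 0\<close> assms(9,10) dom V in \<open>auto simp: g_def\<close>)
    obtain C R where "C > 0" "R > 1"
      and sp: "super_poincare \<theta> \<mu> (super_rate \<theta> ?V (\<lambda>x. C * weight \<kappa> (\<alpha> / \<beta>) \<theta> (B / \<beta>) (max R (norm x))))"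
      using super_poincare_super_rate by blast
    \<comment> \<open>The constant is multiplied by \<open>2 powr (d + \<theta>)\<close> to offset
      the division built into \<open>omega\<close>; \<open>R > 1\<close> makes
      \<open>ln \<rho>\<close> positive, so the powers combine.\<close>
    have "omega \<theta> b \<beta> \<alpha> A B (C * 2 powr (?d + \<theta>)) R
        = (\<lambda>x::'a. C * weight \<kappa> (\<alpha> / \<beta>) \<theta> (B / \<beta>) (max R (norm x)))"
    proof
      fix x :: 'a
      define \<rho> where "\<rho> = max R (norm x)"
      have "\<rho> > 1" using \<open>R > 1\<close> by (simp add: \<rho>_def)
      define l where "l = ln \<rho>"
      have "l > 0" using \<open>\<rho> > 1\<close> by (simp add: l_def)
      have "l powr (\<alpha> / \<beta>) = l powr (\<alpha> / \<beta> - 1) * l"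
        using \<open>l > 0\<close> powr_add[of l "\<alpha> / \<beta> - 1" 1] by simp
      then have "\<rho> powr (\<kappa> * l powr (\<alpha> / \<beta> - 1) - \<theta>) = exp (\<kappa> * l powr (\<alpha> / \<beta>) - \<theta> * l)"
        using \<open>\<rho> > 1\<close> by (simp add: powr_def[of \<rho>] l_def[symmetric] left_diff_distrib mult.assoc)
      then show "omega \<theta> b \<beta> \<alpha> A B (C * 2 powr (?d + \<theta>)) R x
          = C * weight \<kappa> (\<alpha> / \<beta>) \<theta> (B / \<beta>) (max R (norm x))"
        unfolding omega_def Let_def \<kappa>_def[symmetric] \<rho>_def[symmetric] weight_def l_def[symmetric] by simp
    qed
    with sp \<open>C > 0\<close> \<open>R > 1\<close> show ?thesis
      by (intro exI[of _ "C * 2 powr (?d + \<theta>)"] exI[of _ R] conjI) auto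
  qed
  show ?thesis unfolding gibbs using weak super by blast
qed

end
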